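(* Let $\mathbf{x}(k),\mathbf{y}(k)$ be the iterates of the algorithm described in the context with step-size $\eta$. For $\eta>0$ put $\lambda=\max\left(|1-\alpha n\eta(\boldsymbol{\pi}_r^\top\boldsymbol{\pi}_c)|,\,|1-\beta n\eta(\boldsymbol{\pi}_r^\top\boldsymbol{\pi}_c)|\right)$ and define $$\mathbf{t}(k)=\begin{bmatrix}\|\mathbf{x}(k)-A_\infty\mathbf{x}(k)\|_A\\ \|A_\infty\mathbf{x}(k)-\mathbf{1}_n\otimes\mathbf{x}^*\|_2\\ \|\mathbf{y}(k)-B_\infty\mathbf{y}(k)\|_B\end{bmatrix},\qquad J(\eta)=\begin{bmatrix}\sigma_A+a_1\eta & a_2\eta & a_3\eta\\ a_4\eta & \lambda & a_5\eta\\ a_6+a_7\eta & a_8\eta & \sigma_B+a_9\eta\end{bmatrix},$$ where $a_1=mg\beta\,|||I_{np}-A_\infty|||_2\,|||B_\infty|||_2$, $a_2=m\beta\,|||I_{np}-A_\infty|||_2\,|||B_\infty|||_2$, $a_3=mh\,|||I_{np}-A_\infty|||_2$, $a_4=n\beta g(\boldsymbol{\pi}_r^\top\boldsymbol{\pi}_c)$, $a_5=h\,|||A_\infty|||_2$, $a_6=g\sigma_B l\beta\,|||A-I_{np}|||_2$, $a_7=g\sigma_B l\beta^2\,|||B_\infty|||_2$, $a_8=\sigma_B l\beta^2\,|||B_\infty|||_2$, $a_9=h\sigma_B l\beta$. (1) If $0<\eta<\frac{2}{n\beta\boldsymbol{\pi}_r^\top\boldsymbol{\pi}_c}$, then, entry-wise,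 $\mathbf{t}(k+1)\le J(\eta)\,\mathbf{t}(k)$ for all $k\ge 0$. (2) Let $\epsilon_1,\epsilon_2,\epsilon_3$ be positive constants such that $$\epsilon_3>0,\qquad \epsilon_1<\frac{(1-\sigma_B)\epsilon_3}{a_6},\qquad \epsilon_2>\frac{a_4\epsilon_1+a_5\epsilon_3}{\alpha n(\boldsymbol{\pi}_r^\top\boldsymbol{\pi}_c)}.$$ If $$0<\eta<\min\left\{\frac{\epsilon_1(1-\sigma_A)}{a_1\epsilon_1+a_2\epsilon_2+a_3\epsilon_3},\ \frac{(1-\sigma_B)\epsilon_3-\epsilon_1a_6}{a_7\epsilon_1+a_8\epsilon_2+a_9\epsilon_3},\ \frac{1}{n\beta\boldsymbol{\pi}_r^\top\boldsymbol{\pi}_c}\right\},$$ then the spectral radius satisfies $\rho(J(\eta))<1$, and therefore $\|\mathbf{x}(k)-\mathbf{1}_n\otimes\mathbf{x}^*\|_2$ converges to zero geometrically at the rate $O(\rho(J(\eta))^k)$.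
   Context: Graph and weights. There are $n\ge 2$ agents $\mathcal{V}=\{1,\dots,n\}$ communicating over a strongly-connected directed graph $\mathcal{G}=(\mathcal{V},\mathcal{E})$, where $(i,j)\in\mathcal{E}$ means agent $j$ can send information to agent $i$. $\mathcal{N}_i^{\mathrm{in}}$ is the set of agents that can send information to $i$ and $\mathcal{N}_i^{\mathrm{out}}$ the set of agents to which $i$ can send information; both include $i$ itself. The matrix $\underline{A}=\{a_{ij}\}\in\mathbb{R}^{n\times n}$ satisfies $a_{ij}>0$ if $j\in\mathcal{N}_i^{\mathrm{in}}$, $a_{ij}=0$ otherwise, and $\sum_j a_{ij}=1$ for all $i$ (row-stochastic). The matrix $\underline{B}=\{b_{ij}\}$ satisfies $b_{ij}>0$ if $i\in\mathcal{N}_j^{\mathrm{out}}$, $b_{ij}=0$ otherwise, and $\sum_i b_{ij}=1$ for all $j$ (column-stochastic). (The doubly indexed weights $a_{ij}$ are unrelated to the constants $a_1,\dots,a_9$.) $\boldsymbol{\pi}_r$ is the left eigenvector of $\underline{A}$ for eigenvalue $1$ with $\boldsymbol{\pi}_r^\top\mathbf{1}_n=1$; $\boldsymbol{\pi}_c$ is the right eigenvector of $\underline{B}$ for eigenvalue $1$ with $\mathbf{1}_n^\top\boldsymbol{\pi}_c=1$; $\mathbf{1}_n$ is the all-ones vector. Put $A=\underline{A}\otimes I_p$, $B=\underline{B}\otimes I_p$ (Kronecker product), $A_\infty=\lim_{k\to\infty}A^k=(\mathbf{1}_n\boldsymbol{\pi}_r^\top)\otimes I_p$, $B_\infty=\lim_{k\to\infty}B^k=(\boldsymbol{\pi}_c\mathbf{1}_n^\top)\otimes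 I_p$. Functions. Each $f_i:\mathbb{R}^p\to\mathbb{R}$ is differentiable and there are constants $\alpha,\beta>0$ such that for all $i$ and all $\mathbf{x}_1,\mathbf{x}_2\in\mathbb{R}^p$: $\|\nabla f_i(\mathbf{x}_1)-\nabla f_i(\mathbf{x}_2)\|_2\le\beta\|\mathbf{x}_1-\mathbf{x}_2\|_2$ and $f_i(\mathbf{x}_1)-f_i(\mathbf{x}_2)\le\nabla f_i(\mathbf{x}_1)^\top(\mathbf{x}_1-\mathbf{x}_2)-\frac{\alpha}{2}\|\mathbf{x}_1-\mathbf{x}_2\|_2^2$. $\mathbf{x}^*\in\mathbb{R}^p$ denotes the unique minimizer of $F(\mathbf{x})=\frac1n\sum_{i=1}^n f_i(\mathbf{x})$. Algorithm. With $\mathbf{x}(k),\mathbf{y}(k)\in\mathbb{R}^{np}$ stacking local variables $\mathbf{x}_i(k),\mathbf{y}_i(k)\in\mathbb{R}^p$ and $\nabla\mathbf{f}(k)\in\mathbb{R}^{np}$ stacking $\nabla f_i(\mathbf{x}_i(k))$, $i=1,\dots,n$: $\mathbf{x}(0)$ is arbitrary, $\mathbf{y}(0)=\nabla\mathbf{f}(0)$, and for $k\ge0$ $$\mathbf{x}(k+1)=A\mathbf{x}(k)-\eta\,\mathbf{y}(k),\qquad \mathbf{y}(k+1)=B\big(\mathbf{y}(k)+\nabla\mathbf{f}(k+1)-\nabla\mathbf{f}(k)\big).$$ Norms. $\|\cdot\|_2$ is the Euclidean norm and $|||\cdot|||_2$ the spectral norm. $\|\cdot\|_A,\|\cdot\|_B$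 are fixed vector norms on $\mathbb{R}^{np}$, compatible with matrix norms $|||\cdot|||_A,|||\cdot|||_B$ respectively (i.e. $\|X\mathbf{v}\|_A\le|||X|||_A\|\mathbf{v}\|_A$, and likewise for $B$), and $\sigma_A,\sigma_B\in(0,1)$ are constants with $|||A-A_\infty|||_A\le\sigma_A$ and $|||B-B_\infty|||_B\le\sigma_B$; in particular $\|A\mathbf{a}-A_\infty\mathbf{a}\|_A\le\sigma_A\|\mathbf{a}-A_\infty\mathbf{a}\|_A$ and $\|B\mathbf{a}-B_\infty\mathbf{a}\|_B\le\sigma_B\|\mathbf{a}-B_\infty\mathbf{a}\|_B$ for all $\mathbf{a}\in\mathbb{R}^{np}$. The positive constants $h,g,l,m$ are norm-equivalence constants on $\mathbb{R}^{np}$: $\|\cdot\|_2\le h\|\cdot\|_B$, $\|\cdot\|_2\le g\|\cdot\|_A$, $\|\cdot\|_B\le l\|\cdot\|_2$, $\|\cdot\|_A\le m\|\cdot\|_2$. *)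

theory Defs
  imports
    "HOL-Analysis.Analysis"
    "HOL-Library.Landau_Symbols"
    "Jordan_Normal_Form.Spectral_Radius"
begin

(* Vectors in R^n, R^p and R^(np) are HOL-Analysis vectors; the index type of R^(np) is 'n \<times> 'p,
   so the entry (i, a) is the a-th coordinate of the block of agent i.  Only the 3 x 3 comparison
   system lives in the carrier-based matrix type of Jordan_Normal_Form, which has spectral_radius.
   Clashing notation and names are resolved in favour of HOL-Analysis. *)

no_notation Matrix.vec_index (infixl "$" 100)
no_notation Matrix.scalar_prod (infix "\<bullet>" 70)
hide_const (open) Matrix.mat Matrix.vec Matrix.row Determinant.det
hide_type (open) Matrix.vec Matrix.mat

text \<open>An edge \<open>(i, j)\<close> means that \<open>j\<close> can send information to \<open>i\<close>.\<close>

definition in_neighbors :: "('n \<times> 'n) set \<Rightarrow> 'n \<Rightarrow> 'n set" where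
  "in_neighbors E i = insert i {j. (i, j) \<in> E}"

definition out_neighbors :: "('n \<times> 'n) set \<Rightarrow> 'n \<Rightarrow> 'n set" where
  "out_neighbors E i = insert i {j. (j, i) \<in> E}"

definition strongly_connected :: "('n \<times> 'n) set \<Rightarrow> bool" where
  "strongly_connected E \<longleftrightarrow> (\<forall>i j. (i, j) \<in> E\<^sup>*)"

definition stack :: "('n::finite \<Rightarrow> real^'p) \<Rightarrow> real^('n \<times> 'p)" where
  "stack v = (\<chi> ia. v (fst ia) $ snd ia)"

definition block :: "'n::finite \<Rightarrow> real^('n \<times> 'p::finite) \<Rightarrow> real^'p" where
  "block i z = (\<chi> a. z $ (i, a))"

definition kron :: "real^'b^'a \<Rightarrow> real^'d^'c \<Rightarrow> real^('b \<times> 'd)^('a \<times> 'c)" where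
  "kron M N = (\<chi> r s. M $ fst r $ fst s * N $ snd r $ snd s)"

definition kron_vec :: "real^'n \<Rightarrow> real^'p \<Rightarrow> real^('n \<times> 'p)" where
  "kron_vec u v = (\<chi> r. u $ fst r * v $ snd r)"

definition outer_prod :: "real^'m \<Rightarrow> real^'n \<Rightarrow> real^'n^'m" where
  "outer_prod u v = (\<chi> i j. u $ i * v $ j)"

definition spectral_norm :: "real^'m^'n \<Rightarrow> real" where
  "spectral_norm M = onorm (\<lambda>v. M *v v)"

definition is_norm :: "('a::real_vector \<Rightarrow> real) \<Rightarrow> bool" where
  "is_norm N \<longleftrightarrow>
     (\<forall>v. 0 \<le> N v) \<and> (\<forall>v. N v = 0 \<longleftrightarrow> v = 0) \<and>
     (\<forall>c v. N (c *\<^sub>R v) = \<bar>c\<bar> * N v) \<and> (\<forall>v w. N (v + w) \<le> N v + N w)"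

text \<open>Submultiplicativity of the matrix norm is not required.\<close>

definition compatible_norms :: "(real^'m \<Rightarrow> real) \<Rightarrow> (real^'m^'m \<Rightarrow> real) \<Rightarrow> bool" where
  "compatible_norms N MN \<longleftrightarrow>
     is_norm N \<and> is_norm MN \<and> (\<forall>M v. N (M *v v) \<le> MN M * N v)"

text \<open>
  In the main statement \<open>Ainf\<close> and \<open>Binf\<close> are given by their closed forms
  \<open>(\<one>\<pi>\<^sub>r\<^sup>T) \<otimes> I\<close> and \<open>(\<pi>\<^sub>c\<one>\<^sup>T) \<otimes> I\<close>.  The lemmas below show that, under the
  hypotheses made there, these are indeed the limits of the powers of \<open>A\<close> and \<open>B\<close>.
  The power is spelled out because \<open>^\<close> on \<^typ>\<open>real^'m^'m\<close> is componentwise.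
\<close>

definition mat_power :: "real^'m^'m \<Rightarrow> nat \<Rightarrow> real^'m^'m" where
  "mat_power M k = (((**) M) ^^ k) (mat 1)"

lemma matrix_mult_diff_left:
  fixes M N :: "real^'m^'n" and P :: "real^'k^'m"
  shows "(M - N) ** P = M ** P - N ** P"
  by (simp add: Finite_Cartesian_Product.vec_eq_iff matrix_matrix_mult_def left_diff_distrib
      sum_subtractf)

lemma matrix_mult_diff_right:
  fixes M N :: "real^'m^'n" and P :: "real^'n^'k"
  shows "P ** (M - N) = P ** M - P ** N"
  by (simp add: Finite_Cartesian_Product.vec_eq_iff matrix_matrix_mult_def right_diff_distrib
      sum_subtractf)

lemma mat_power_tendsto_projection:
  fixes M L :: "real^'m^'m"
  assumes N: "compatible_norms N MN" and eq: "\<And>v. norm v \<le> c * N v" and c: "0 < c"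
    and eqML: "M ** L = L" and eqLM: "L ** M = L" and eqLL: "L ** L = L"
    and bound: "MN (M - L) \<le> s" and s: "0 < s" "s < 1"
  shows "(\<lambda>k. mat_power M k) \<longlonglongrightarrow> L"
proof -
  have LP: "L ** mat_power M k = L" for k
    by (induction k) (simp_all add: mat_power_def matrix_mul_assoc eqLM)
  have step: "mat_power M (Suc k) - L = (M - L) ** (mat_power M k - L)" for k
  proof -
    have "(M - L) ** (mat_power M k - L) =
        M ** mat_power M k - M ** L - (L ** mat_power M k - L ** L)"
      by (simp add: matrix_mult_diff_left matrix_mult_diff_right)
    then show ?thesis by (simp add: eqML eqLL LP) (simp add: mat_power_def)
  qed
  have nonneg: "0 \<le> N v" for v
    using N by (simp add: compatible_norms_def is_norm_def)
  have contr: "N ((mat_power M k - L) *v v) \<le> s ^ k * N ((mat 1 - L) *v v)" for k v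
  proof (induction k)
    case 0
    then show ?case by (simp add: mat_power_def)
  next
    case (Suc k)
    have "N ((mat_power M (Suc k) - L) *v v) = N ((M - L) *v ((mat_power M k - L) *v v))"
      by (simp only: step matrix_vector_mul_assoc)
    also have "\<dots> \<le> MN (M - L) * N ((mat_power M k - L) *v v)"
      using N by (simp add: compatible_norms_def)
    also have "\<dots> \<le> s * N ((mat_power M k - L) *v v)"
      using bound nonneg by (intro mult_right_mono)
    also have "\<dots> \<le> s * (s ^ k * N ((mat 1 - L) *v v))"
      using Suc s by (intro mult_left_mono) auto
    finally show ?case by (simp add: mult.assoc)
  qed
  have "(\<lambda>k. mat_power M k $ i $ j) \<longlonglongrightarrow> L $ i $ j" for i j
  proof -
    define C where "C = c * N ((mat 1 - L) *v axis j 1)"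
    have "\<bar>mat_power M k $ i $ j - L $ i $ j\<bar> \<le> C * s ^ k" for k
    proof -
      have "\<bar>mat_power M k $ i $ j - L $ i $ j\<bar> = \<bar>((mat_power M k - L) *v axis j 1) $ i\<bar>"
        by (simp add: matrix_vector_mul_component inner_axis)
      also have "\<dots> \<le> norm ((mat_power M k - L) *v axis j 1)"
        by (rule component_le_norm_cart)
      also have "\<dots> \<le> c * N ((mat_power M k - L) *v axis j 1)"
        by (rule eq)
      also have "\<dots> \<le> c * (s ^ k * N ((mat 1 - L) *v axis j 1))"
        using contr c by (intro mult_left_mono) auto
      finally show ?thesis by (simp add: C_def algebra_simps)
    qed
    then have "\<forall>\<^sub>F k in sequentially. norm (mat_power M k $ i $ j - L $ i $ j) \<le> C * s ^ k"
      by (intro always_eventually allI) (simp only: real_norm_def)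
    moreover have "(\<lambda>k. C * s ^ k) \<longlonglongrightarrow> 0"
      using s by (intro tendsto_mult_right_zero LIMSEQ_power_zero) auto
    ultimately have "(\<lambda>k. mat_power M k $ i $ j - L $ i $ j) \<longlonglongrightarrow> 0"
      by (rule Lim_null_comparison)
    then show ?thesis by (simp add: LIM_zero_iff)
  qed
  then show ?thesis by (intro vec_tendstoI)
qed

lemma kron_mult:
  fixes M :: "real^'b^'a" and N :: "real^'d^'c" and P :: "real^'e^'b" and Q :: "real^'f^'d"
  shows "kron M N ** kron P Q = kron (M ** P) (N ** Q)"
proof -
  have "(\<Sum>k\<in>UNIV. (M $ i $ fst k * N $ j $ snd k) * (P $ fst k $ i' * Q $ snd k $ j')) =
      (\<Sum>k\<in>UNIV. M $ i $ k * P $ k $ i') * (\<Sum>k\<in>UNIV. N $ j $ k * Q $ k $ j')" for i j i' j'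
    unfolding sum_product sum.cartesian_product UNIV_Times_UNIV
    by (intro sum.cong) (auto simp: mult_ac)
  then show ?thesis
    by (simp add: Finite_Cartesian_Product.vec_eq_iff kron_def matrix_matrix_mult_def)
qed

lemma outer_prod_mult_right: "outer_prod u v ** M = outer_prod u (v v* M)"
  by (simp add: Finite_Cartesian_Product.vec_eq_iff outer_prod_def matrix_matrix_mult_def vector_matrix_mult_def
      sum_distrib_left mult_ac)

lemma mult_outer_prod: "M ** outer_prod u v = outer_prod (M *v u) v"
  by (simp add: Finite_Cartesian_Product.vec_eq_iff outer_prod_def matrix_matrix_mult_def matrix_vector_mult_def
      sum_distrib_right sum_distrib_left mult_ac)

lemma outer_prod_idem: "v \<bullet> u = 1 \<Longrightarrow> outer_prod u v ** outer_prod u v = outer_prod u v"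
proof (unfold mult_outer_prod, rule arg_cong[where f = "\<lambda>w. outer_prod w v"])
  assume *: "v \<bullet> u = 1"
  have "(outer_prod u v *v u) $ i = u $ i * (v \<bullet> u)" for i
    by (simp add: outer_prod_def matrix_vector_mult_def inner_vec_def sum_distrib_left mult_ac)
  with * show "outer_prod u v *v u = u" by (simp add: Finite_Cartesian_Product.vec_eq_iff)
qed

lemma A_powers_tendsto:
  fixes Au :: "real^'n^'n" and \<pi> :: "real^'n"
  assumes "\<And>i. (\<Sum>j\<in>UNIV. Au $ i $ j) = 1" and "\<pi> v* Au = \<pi>" and "\<pi> \<bullet> 1 = 1"
    and "compatible_norms N MN" and "\<And>v. norm v \<le> c * N v" and "0 < c"
    and "MN (kron Au (mat 1 :: real^'p^'p) - kron (outer_prod 1 \<pi>) (mat 1)) \<le> s"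
    and "0 < s" "s < 1"
  shows "(\<lambda>k. mat_power (kron Au (mat 1 :: real^'p^'p)) k)
           \<longlonglongrightarrow> kron (outer_prod 1 \<pi>) (mat 1)"
proof -
  have "Au *v 1 = 1"
    using assms(1) by (simp add: Finite_Cartesian_Product.vec_eq_iff matrix_vector_mult_def)
  then show ?thesis
    using assms(2-)
    by (intro mat_power_tendsto_projection[OF assms(4,5,6) _ _ _ assms(7,8,9)])
       (simp_all add: kron_mult mult_outer_prod[of Au] outer_prod_mult_right[of _ _ Au]
         outer_prod_idem)
qed

lemma B_powers_tendsto:
  fixes Bu :: "real^'n^'n" and \<pi> :: "real^'n"
  assumes "\<And>j. (\<Sum>i\<in>UNIV. Bu $ i $ j) = 1" and "Bu *v \<pi> = \<pi>" and "1 \<bullet> \<pi> = 1"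
    and "compatible_norms N MN" and "\<And>v. norm v \<le> c * N v" and "0 < c"
    and "MN (kron Bu (mat 1 :: real^'p^'p) - kron (outer_prod \<pi> 1) (mat 1)) \<le> s"
    and "0 < s" "s < 1"
  shows "(\<lambda>k. mat_power (kron Bu (mat 1 :: real^'p^'p)) k)
           \<longlonglongrightarrow> kron (outer_prod \<pi> 1) (mat 1)"
proof -
  have "1 v* Bu = 1"
    using assms(1) by (simp add: Finite_Cartesian_Product.vec_eq_iff vector_matrix_mult_def)
  then show ?thesis
    using assms(2-)
    by (intro mat_power_tendsto_projection[OF assms(4,5,6) _ _ _ assms(7,8,9)])
       (simp_all add: kron_mult mult_outer_prod[of Bu] outer_prod_mult_right[of _ _ Bu]
         outer_prod_idem)
qed

end

theory Submission
  imports Defs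
begin

text \<open>
  The three error components satisfy a linear system of inequalities: the consensus errors contract
  by \<open>\<sigma>\<^sub>A\<close> and \<open>\<sigma>\<^sub>B\<close>; averaging with \<open>A\<^sub>\<infinity>\<close> yields an inexact gradient step on \<open>\<Sum>\<^sub>i f\<^sub>i\<close> of
  length \<open>\<eta> \<pi>\<^sub>r\<^sup>T\<pi>\<^sub>c\<close>, a contraction by \<open>\<lambda>\<close>; and column-stochasticity preserves
  \<open>B\<^sub>\<infinity> y(k) = B\<^sub>\<infinity> \<nabla>f(k)\<close>, which bounds \<open>y(k)\<close> by the errors because the gradients sum to zero at
  \<open>x\<^sup>*\<close>.  The step-size bounds say exactly that \<open>J(\<eta>) \<epsilon> < \<epsilon>\<close> with \<open>\<epsilon> > 0\<close>, hence \<open>\<rho>(J(\<eta>)) < 1\<close>.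
  Since \<open>J(\<eta>)\<close> is entrywise positive it has a positive eigenvector \<open>v\<close>; dominating \<open>t(0)\<close> by
  a multiple of \<open>v\<close> gives decay at the rate \<open>\<rho>(J(\<eta>))\<^sup>k\<close> without a polynomial factor.
\<close>

subsection \<open>Smooth strongly convex functions\<close>

text \<open>Up to the constant \<open>S z\<close>, \<psi> is \<open>S\<close> along the segment from
  \<open>z\<close> to \<open>w\<close> minus its quadratic model. Cauchy-Schwarz and the Lipschitz
  bound make its derivative nonpositive for \<open>s \<ge> 0\<close>, so \<psi> decreases from 0 to
  1.\<close>

lemma descent_lemma:
  fixes S :: "'a::real_inner \<Rightarrow> real"
  assumes grad: "\<And>z. GDERIV S z :> G z"
    and lip: "\<And>z w. norm (G z - G w) \<le> L * norm (z - w)"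
  shows "S w \<le> S z + G z \<bullet> (w - z) + L / 2 * (norm (w - z))\<^sup>2"
proof -
  define d where "d = w - z"
  define \<psi> where "\<psi> s = S (z + s *\<^sub>R d) - s * (G z \<bullet> d) - L / 2 * s\<^sup>2 * (norm d)\<^sup>2" for s :: real
  have deriv: "(\<psi> has_real_derivative (G (z + s *\<^sub>R d) - G z) \<bullet> d - L * s * (norm d)\<^sup>2) (at s)" for s
  proof -
    have "((\<lambda>s. S (z + s *\<^sub>R d)) has_derivative (\<lambda>r. (r *\<^sub>R d) \<bullet> G (z + s *\<^sub>R d))) (at s)"
    proof (rule has_derivative_compose[where f = "\<lambda>s. z + s *\<^sub>R d" and g = S
          and f' = "\<lambda>r. r *\<^sub>R d" and g' = "\<lambda>h. h \<bullet> G (z + s *\<^sub>R d)"])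
      show "((\<lambda>s. z + s *\<^sub>R d) has_derivative (\<lambda>r. r *\<^sub>R d)) (at s)"
        by (auto intro!: derivative_eq_intros)
      show "(S has_derivative (\<lambda>h. h \<bullet> G (z + s *\<^sub>R d))) (at (z + s *\<^sub>R d))"
        using grad by (simp add: gderiv_def)
    qed
    then have "((\<lambda>s. S (z + s *\<^sub>R d)) has_real_derivative d \<bullet> G (z + s *\<^sub>R d)) (at s)"
      by (simp add: has_field_derivative_def mult_commute_abs)
    note [derivative_intros] = this
    have "(\<psi> has_real_derivative d \<bullet> G (z + s *\<^sub>R d) - G z \<bullet> d - L * s * (norm d)\<^sup>2) (at s)"
      unfolding \<psi>_def by (auto intro!: derivative_eq_intros)
    then show ?thesis by (simp add: inner_diff_left inner_commute[of d])
  qed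
  have nonpos: "(G (z + s *\<^sub>R d) - G z) \<bullet> d - L * s * (norm d)\<^sup>2 \<le> 0" if "0 \<le> s" for s
  proof -
    have "(G (z + s *\<^sub>R d) - G z) \<bullet> d \<le> norm (G (z + s *\<^sub>R d) - G z) * norm d"
      by (rule norm_cauchy_schwarz)
    also have "\<dots> \<le> (L * norm (z + s *\<^sub>R d - z)) * norm d"
      by (intro mult_right_mono lip) auto
    finally show ?thesis using that by (simp add: power2_eq_square mult_ac)
  qed
  have "\<psi> 1 \<le> \<psi> 0"
    using deriv nonpos by (intro DERIV_nonpos_imp_nonincreasing[of 0 1 \<psi>]) (simp, blast)
  then show ?thesis by (simp add: \<psi>_def d_def)
qed

locale strongly_convex_smooth =
  fixes S :: "'a::real_inner \<Rightarrow> real" and G :: "'a \<Rightarrow> 'a" and a b :: real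
  assumes grad: "\<And>z. GDERIV S z :> G z"
    and lip: "\<And>z w. norm (G z - G w) \<le> b * norm (z - w)"
    and sc: "\<And>z w. S z - S w \<le> G z \<bullet> (z - w) - a / 2 * (norm (z - w))\<^sup>2"
begin

text \<open>Compares the quadratic upper bound at \<open>z\<close> with the lower bound at \<open>w\<close>, both taken at the
  point \<^term>\<open>z - \<tau> *\<^sub>R (G z - G w - a *\<^sub>R (z - w))\<close>.\<close>

lemma bregman_lower_bound:
  "(2 * \<tau> - (b - a) * \<tau>\<^sup>2) * (norm (G z - G w - a *\<^sub>R (z - w)))\<^sup>2 / 2
    \<le> S z - S w - G w \<bullet> (z - w) - a / 2 * (norm (z - w))\<^sup>2"
proof -
  define u where "u = G z - G w - a *\<^sub>R (z - w)"
  define d where "d = z - w"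
  define p where "p = z - \<tau> *\<^sub>R u"
  have "S w + G w \<bullet> (d - \<tau> *\<^sub>R u) + a / 2 * (norm (d - \<tau> *\<^sub>R u))\<^sup>2 \<le> S p"
    using sc[of w p] by (simp add: p_def d_def algebra_simps norm_minus_commute inner_diff_right)
  also have "S p \<le> S z - \<tau> * (G z \<bullet> u) + b / 2 * (\<tau>\<^sup>2 * (norm u)\<^sup>2)"
    using descent_lemma[OF grad lip, of p z] by (simp add: p_def power_mult_distrib)
  finally have "S w + G w \<bullet> (d - \<tau> *\<^sub>R u) + a / 2 * (norm (d - \<tau> *\<^sub>R u))\<^sup>2
      \<le> S z - \<tau> * (G z \<bullet> u) + b / 2 * (\<tau>\<^sup>2 * (norm u)\<^sup>2)" .
  moreover have "(norm (d - \<tau> *\<^sub>R u))\<^sup>2 = (norm d)\<^sup>2 - 2 * \<tau> * (d \<bullet> u) + \<tau>\<^sup>2 * (norm u)\<^sup>2"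
    unfolding power2_norm_eq_inner
    by (simp add: inner_diff_left inner_diff_right inner_commute power2_eq_square)
  moreover have "G z \<bullet> u = (norm u)\<^sup>2 + G w \<bullet> u + a * (d \<bullet> u)"
  proof -
    have "G z = u + G w + a *\<^sub>R d" by (simp add: u_def d_def)
    then show ?thesis by (simp add: inner_add_left power2_norm_eq_inner)
  qed
  ultimately have "(2 * \<tau> - (b - a) * \<tau>\<^sup>2) * (norm u)\<^sup>2 / 2
      \<le> S z - S w - G w \<bullet> d - a / 2 * (norm d)\<^sup>2"
    by (simp add: inner_diff_right field_simps)
  then show ?thesis by (simp add: u_def d_def)
qed

text \<open>Adding the Bregman bounds for \<open>(z, w)\<close> and \<open>(w, z)\<close> cancels
  the function values. The parameter \<tau> stays free because its best choice depends on whether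
  \<open>a = b\<close>.\<close>

lemma cocoercive_aux:
  "(2 * \<tau> - (b - a) * \<tau>\<^sup>2) * (norm (G z - G w - a *\<^sub>R (z - w)))\<^sup>2
    \<le> (G z - G w - a *\<^sub>R (z - w)) \<bullet> (z - w)"
proof -
  have "G w - G z - a *\<^sub>R (w - z) = - (G z - G w - a *\<^sub>R (z - w))"
    by (simp add: algebra_simps)
  then have "norm (G w - G z - a *\<^sub>R (w - z)) = norm (G z - G w - a *\<^sub>R (z - w))"
    by (simp only: norm_minus_cancel)
  then have "(2 * \<tau> - (b - a) * \<tau>\<^sup>2) * (norm (G z - G w - a *\<^sub>R (z - w)))\<^sup>2
      \<le> - (G w \<bullet> (z - w)) - G z \<bullet> (w - z) - a * (norm (z - w))\<^sup>2"
    using bregman_lower_bound[of \<tau> z w] bregman_lower_bound[of \<tau> w z]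
    by (simp add: norm_minus_commute[of w z])
  also have "\<dots> = (G z - G w - a *\<^sub>R (z - w)) \<bullet> (z - w)"
    by (simp add: power2_norm_eq_inner algebra_simps inner_commute)
  finally show ?thesis .
qed

lemma strong_monotone: "a * (norm (z - w))\<^sup>2 \<le> (G z - G w) \<bullet> (z - w)"
  \<comment> \<open>At \<tau> = 0 the quadratic term disappears and plain monotonicity of
    \<open>G - a\<close> remains.\<close>
  using cocoercive_aux[of 0 z w] by (simp add: inner_diff_left power2_norm_eq_inner)

text \<open>Strong monotonicity and the Lipschitz bound enclose the same inner product; two distinct
  points are needed to cancel the squared distance.\<close>

lemma convexity_le_smoothness:
  assumes "z \<noteq> (w :: 'a)"
  shows "a \<le> b"
proof -
  have "a * (norm (z - w))\<^sup>2 \<le> norm (G z - G w) * norm (z - w)"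
    using strong_monotone norm_cauchy_schwarz by (rule order_trans)
  also have "\<dots> \<le> b * norm (z - w) * norm (z - w)"
    by (intro mult_right_mono lip) auto
  finally show ?thesis
    using assms by (simp add: power2_eq_square mult.assoc)
qed

text \<open>Expanding the second factor reduces the claim to an upper bound on the squared norm of
  \<open>u\<close> by \<open>(b - a) * (u \<bullet> (z - w))\<close>, which a suitable \<tau> in
  \<open>cocoercive_aux\<close> provides.\<close>

lemma cocoercive:
  "0 \<le> (G z - G w - a *\<^sub>R (z - w)) \<bullet> (b *\<^sub>R (z - w) - (G z - G w))"
proof (cases "z = w")
  case False
  define u where "u = G z - G w - a *\<^sub>R (z - w)"
  note aux = cocoercive_aux[of _ z w, folded u_def]
  have "(norm u)\<^sup>2 \<le> (b - a) * (u \<bullet> (z - w))"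
  proof (cases "a = b")
    case True
    have "u = 0"
    proof (rule ccontr)
      assume u: "u \<noteq> 0"
      \<comment> \<open>For \<open>a = b\<close> the left side of \<open>aux\<close> is linear in
        \<tau>, hence unbounded; this \<tau> makes it exceed the right side by exactly 1.\<close>
      define \<tau> where "\<tau> = (u \<bullet> (z - w) + 1) / (2 * (norm u)\<^sup>2)"
      have "2 * \<tau> * (norm u)\<^sup>2 = u \<bullet> (z - w) + 1"
        using u by (simp add: \<tau>_def)
      with aux[of \<tau>] True show False by simp
    qed
    then show ?thesis by simp
  next
    case ab: False
    then have "0 < b - a" using convexity_le_smoothness[OF False] by simp
    \<comment> \<open>This \<tau> maximises the coefficient in \<open>aux\<close>, whose maximum is
      \<open>1 / (b - a)\<close>.\<close>
    with aux[of "1 / (b - a)"] show ?thesis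
      by (simp add: power_divide divide_simps power2_eq_square mult_ac)
  qed
  moreover have "u \<bullet> (b *\<^sub>R (z - w) - (G z - G w)) = (b - a) * (u \<bullet> (z - w)) - (norm u)\<^sup>2"
    by (simp add: u_def power2_norm_eq_inner algebra_simps inner_commute)
  ultimately show ?thesis by (simp add: u_def)
qed simp

text \<open>With \<open>u = G z - G w - a d\<close> and \<open>v = b d - (G z - G w)\<close> for \<open>d = z - w\<close>, one has
  \<open>(b - a) (d - s (G z - G w)) = (1 - s b) u + (1 - s a) v\<close> and \<open>(b - a) d = u + v\<close>, where
  \<open>u \<bullet> v \<ge> 0\<close>.\<close>

lemma gradient_step_contraction:
  "norm ((z - s *\<^sub>R G z) - (w - s *\<^sub>R G w)) \<le> max \<bar>1 - a * s\<bar> \<bar>1 - b * s\<bar> * norm (z - w)"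
proof (cases "z = w")
  case False
  define d where "d = z - w"
  define q where "q = G z - G w"
  define u where "u = q - a *\<^sub>R d"
  define v where "v = b *\<^sub>R d - q"
  define L where "L = max \<bar>1 - a * s\<bar> \<bar>1 - b * s\<bar>"
  have uv: "0 \<le> u \<bullet> v"
    using cocoercive[of z w] by (simp add: u_def v_def d_def q_def)
  have la: "\<bar>1 - a * s\<bar> \<le> L" and lb: "\<bar>1 - b * s\<bar> \<le> L" by (simp_all add: L_def)
  then have l0: "0 \<le> L" by linarith
  have "norm (d - s *\<^sub>R q) \<le> L * norm d"
  proof (cases "a = b")
    \<comment> \<open>Division by \<open>b - a\<close> is impossible here, but
      \<open>v = - u\<close> turns the cocoercivity inequality into \<open>u = 0\<close>, so
      \<open>q\<close> is a multiple of \<open>d\<close>.\<close>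
    case True
    then have "v = - u" by (simp add: u_def v_def)
    with uv have "u \<bullet> u = 0" using inner_ge_zero[of u] by simp
    then have "u = 0" by simp
    then have "q = a *\<^sub>R d" by (simp add: u_def)
    then have "d - s *\<^sub>R q = (1 - a * s) *\<^sub>R d" by (simp add: algebra_simps)
    then show ?thesis using la by (simp add: mult_right_mono)
  next
    case ab: False
    then have ab: "0 < b - a" using convexity_le_smoothness[OF False] by simp
    have 1: "(b - a) *\<^sub>R (d - s *\<^sub>R q) = (1 - b * s) *\<^sub>R u + (1 - a * s) *\<^sub>R v"
      by (simp add: u_def v_def algebra_simps)
    have 2: "(b - a) *\<^sub>R d = u + v"
      by (simp add: u_def v_def algebra_simps)
    have "(norm ((b - a) *\<^sub>R (d - s *\<^sub>R q)))\<^sup>2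
        = (1 - b * s)\<^sup>2 * (norm u)\<^sup>2 + (1 - a * s)\<^sup>2 * (norm v)\<^sup>2
          + 2 * ((1 - b * s) * (1 - a * s)) * (u \<bullet> v)"
      unfolding 1 power2_norm_eq_inner
      by (simp add: inner_add_left inner_add_right inner_commute power2_eq_square algebra_simps)
    \<comment> \<open>Since \<open>u \<bullet> v\<close> is nonnegative, the mixed coefficient may
      also be enlarged to the square of \<open>L\<close>, which completes the square.\<close>
    also have "\<dots> \<le> L\<^sup>2 * (norm u)\<^sup>2 + L\<^sup>2 * (norm v)\<^sup>2 + 2 * L\<^sup>2 * (u \<bullet> v)"
    proof (intro add_mono mult_right_mono mult_left_mono uv)
      show "(1 - b * s)\<^sup>2 \<le> L\<^sup>2" "(1 - a * s)\<^sup>2 \<le> L\<^sup>2"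
        using la lb l0 by (intro abs_le_square_iff[THEN iffD1]; simp)+
      have "\<bar>(1 - b * s) * (1 - a * s)\<bar> \<le> L * L"
        unfolding abs_mult using la lb by (intro mult_mono) auto
      then show "(1 - b * s) * (1 - a * s) \<le> L\<^sup>2"
        by (simp add: power2_eq_square)
    qed auto
    also have "\<dots> = (L * norm ((b - a) *\<^sub>R d))\<^sup>2"
      unfolding 2 power_mult_distrib power2_norm_eq_inner
      by (simp add: inner_add_left inner_add_right inner_commute algebra_simps)
    finally have "norm ((b - a) *\<^sub>R (d - s *\<^sub>R q)) \<le> L * norm ((b - a) *\<^sub>R d)"
      by (rule power2_le_imp_le) (simp add: l0)
    then show ?thesis
      using ab by (simp add: mult.left_commute)
  qed
  then show ?thesis by (simp add: d_def q_def L_def algebra_simps)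
qed simp

end

lemma GDERIV_minimum_eq_0:
  assumes "GDERIV S z :> D" and "\<And>w. S z \<le> S w"
  shows "D = 0"
proof -
  have "(\<lambda>h. h \<bullet> D) = (\<lambda>h. 0)"
    using assms by (intro differential_zero_maxmin[of z UNIV S]) (auto simp: gderiv_def)
  then have "D \<bullet> D = 0" by meson
  then show ?thesis by simp
qed

lemma GDERIV_sum:
  assumes "\<And>i. i \<in> I \<Longrightarrow> GDERIV (f i) z :> D i"
  shows "GDERIV (\<lambda>z. \<Sum>i\<in>I. f i z) z :> (\<Sum>i\<in>I. D i)"
  using has_derivative_sum[of I f "\<lambda>i h. h \<bullet> D i"] assms
  by (simp add: gderiv_def inner_sum_right)

text \<open>All three conditions are additive. Applied to the sum over all agents, this is the
  source of the factor \<open>n\<close> in \<open>lam\<close>.\<close>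

lemma strongly_convex_smooth_sum:
  fixes a b :: real
  assumes "\<And>i. i \<in> I \<Longrightarrow> strongly_convex_smooth (f i) (G i) a b"
  shows "strongly_convex_smooth (\<lambda>z. \<Sum>i\<in>I. f i z) (\<lambda>z. \<Sum>i\<in>I. G i z) (card I * a) (card I * b)"
proof
  show "GDERIV (\<lambda>z. \<Sum>i\<in>I. f i z) z :> (\<Sum>i\<in>I. G i z)" for z
    using assms by (intro GDERIV_sum) (simp add: strongly_convex_smooth_def)
  show "norm ((\<Sum>i\<in>I. G i z) - (\<Sum>i\<in>I. G i w)) \<le> card I * b * norm (z - w)" for z w
  proof -
    have "norm (\<Sum>i\<in>I. G i z - G i w) \<le> (\<Sum>i\<in>I. b * norm (z - w))"
      using assms by (intro sum_norm_le) (simp add: strongly_convex_smooth_def)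
    then show ?thesis by (simp add: sum_subtractf mult.assoc)
  qed
  show "(\<Sum>i\<in>I. f i z) - (\<Sum>i\<in>I. f i w)
      \<le> (\<Sum>i\<in>I. G i z) \<bullet> (z - w) - card I * a / 2 * (norm (z - w))\<^sup>2" for z w
  proof -
    have "(\<Sum>i\<in>I. f i z - f i w) \<le> (\<Sum>i\<in>I. G i z \<bullet> (z - w) - a / 2 * (norm (z - w))\<^sup>2)"
      using assms by (intro sum_mono) (simp add: strongly_convex_smooth_def)
    then show ?thesis by (simp add: sum_subtractf inner_sum_left mult.assoc)
  qed
qed

subsection \<open>Block vectors and norms\<close>

lemma block_diff: "block i (z - w) = block i z - block i w"
  by (simp add: block_def Finite_Cartesian_Product.vec_eq_iff)

lemma block_stack: "block i (stack v) = v i"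
  by (simp add: block_def stack_def Finite_Cartesian_Product.vec_eq_iff)

lemma block_kron_vec: "block i (kron_vec u v) = u $ i *\<^sub>R v"
  by (simp add: block_def kron_vec_def Finite_Cartesian_Product.vec_eq_iff)

lemma kron_vec_add_right: "kron_vec u (v + w) = kron_vec u v + kron_vec u w"
  by (simp add: kron_vec_def Finite_Cartesian_Product.vec_eq_iff algebra_simps)

lemma kron_vec_diff_right: "kron_vec u (v - w) = kron_vec u v - kron_vec u w"
  by (simp add: kron_vec_def Finite_Cartesian_Product.vec_eq_iff algebra_simps)

lemma kron_vec_scaleR_right: "kron_vec u (c *\<^sub>R v) = c *\<^sub>R kron_vec u v"
  by (simp add: kron_vec_def Finite_Cartesian_Product.vec_eq_iff)

text \<open>Covers both limit matrices: \<open>Ainf\<close> copies the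
  \<open>\<pi>\<^sub>r\<close>-weighted average of the blocks to every agent, \<open>Binf\<close>
  distributes the plain sum of the blocks with weights \<open>\<pi>\<^sub>c\<close>.\<close>

lemma kron_outer_prod_mult_vec:
  fixes z :: "real^('n::finite \<times> 'p::finite)"
  shows "kron (outer_prod u \<pi>) (mat 1) *v z = kron_vec u (\<Sum>i\<in>UNIV. \<pi> $ i *\<^sub>R block i z)"
proof -
  have "(\<Sum>s\<in>UNIV. u $ i * \<pi> $ fst s * (mat 1 :: real^'p^'p) $ a $ snd s * z $ s) =
      (\<Sum>j\<in>UNIV. u $ i * \<pi> $ j * z $ (j, a))" for i and a :: 'p
  proof -
    have "(\<Sum>s\<in>UNIV. u $ i * \<pi> $ fst s * (mat 1 :: real^'p^'p) $ a $ snd s * z $ s) =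
        (\<Sum>j\<in>UNIV. \<Sum>b\<in>UNIV. if a = b then u $ i * \<pi> $ j * z $ (j, b) else 0)"
      unfolding sum.cartesian_product UNIV_Times_UNIV
      by (intro sum.cong) (auto simp: Finite_Cartesian_Product.mat_def)
    then show ?thesis by simp
  qed
  then show ?thesis
    by (simp add: kron_def outer_prod_def kron_vec_def block_def matrix_vector_mult_def
        Finite_Cartesian_Product.vec_eq_iff sum_distrib_left mult.assoc)
qed

lemma norm_sq_eq_sum_blocks: "(norm z)\<^sup>2 = (\<Sum>i\<in>UNIV. (norm (block i z))\<^sup>2)"
proof -
  have "(\<Sum>s\<in>UNIV. z $ s * z $ s) = (\<Sum>i\<in>UNIV. \<Sum>a\<in>UNIV. z $ (i, a) * z $ (i, a))"
    unfolding sum.cartesian_product UNIV_Times_UNIV by (intro sum.cong) auto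
  then show ?thesis
    by (simp add: power2_norm_eq_inner inner_vec_def block_def)
qed

lemma norm_kron_vec_1: "norm (kron_vec (1 :: real^'n) v) = sqrt CARD('n) * norm v"
proof -
  have "(norm (kron_vec (1 :: real^'n) v))\<^sup>2 = (sqrt CARD('n) * norm v)\<^sup>2"
    by (simp add: norm_sq_eq_sum_blocks block_kron_vec power_mult_distrib)
  then show ?thesis
    by (simp add: power2_eq_iff_nonneg)
qed

lemma norm_le_blockwise:
  assumes "\<And>i. norm (block i z) \<le> c * norm (block i w)" and "0 \<le> c"
  shows "norm z \<le> c * norm w"
proof (rule power2_le_imp_le)
  have "(\<Sum>i\<in>UNIV. (norm (block i z))\<^sup>2) \<le> (\<Sum>i\<in>UNIV. (c * norm (block i w))\<^sup>2)"
    by (intro sum_mono power_mono assms(1)) simp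
  then show "(norm z)\<^sup>2 \<le> (c * norm w)\<^sup>2"
    by (simp add: norm_sq_eq_sum_blocks power_mult_distrib sum_distrib_left)
qed (use assms(2) in simp)

text \<open>Cauchy-Schwarz over the agents; its factor, together with the one in
  \<open>norm_kron_vec_1\<close>, yields the \<open>n\<close> in \<open>a\<^sub>4\<close>.\<close>

lemma sum_norm_block_le:
  fixes z :: "real^('n::finite \<times> 'p::finite)"
  shows "(\<Sum>i\<in>UNIV. norm (block i z)) \<le> sqrt CARD('n) * norm z"
proof (rule power2_le_imp_le)
  have "(\<Sum>i\<in>UNIV. norm (block i z))\<^sup>2 \<le> (\<Sum>i\<in>UNIV. (norm (block i z))\<^sup>2) * CARD('n)"
    by (rule sum_squared_le_sum_of_squares)
  then show "(\<Sum>i\<in>UNIV. norm (block i z))\<^sup>2 \<le> (sqrt CARD('n) * norm z)\<^sup>2"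
    by (simp add: norm_sq_eq_sum_blocks power_mult_distrib mult.commute)
qed simp

lemma norm_mult_le_spectral_norm: "norm (M *v v) \<le> spectral_norm M * norm v"
  unfolding spectral_norm_def by (rule onorm[OF matrix_vector_mul_bounded_linear])

lemma spectral_norm_nonneg: "0 \<le> spectral_norm M"
  unfolding spectral_norm_def by (rule onorm_pos_le[OF matrix_vector_mul_bounded_linear])

text \<open>Serves to show that the coefficients in \<open>J\<close> are strictly positive, as the
  Perron argument requires.\<close>

lemma spectral_norm_pos:
  assumes "M \<noteq> 0"
  shows "0 < spectral_norm M"
proof -
  have "spectral_norm M \<noteq> 0"
  proof
    assume "spectral_norm M = 0"
    then have "M *v v = 0 *v v" for v
      by (simp add: spectral_norm_def onorm_eq_0 matrix_vector_mul_bounded_linear)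
    then have "M = 0" unfolding matrix_eq by blast
    with assms show False by simp
  qed
  then show ?thesis using spectral_norm_nonneg[of M] by simp
qed

lemma matrix_mult_diff_scaleR_vec:
  fixes M :: "real^'m^'n"
  shows "M *v (v - c *\<^sub>R w) = M *v v - c *\<^sub>R (M *v w)"
  by (simp add: matrix_vector_mult_diff_distrib matrix_vector_mult_scaleR)

lemma is_norm_diff_scaleR:
  assumes N: "is_norm N" and "0 \<le> c"
  shows "N (v - c *\<^sub>R w) \<le> N v + c * N w"
proof -
  have "N (v + (- c) *\<^sub>R w) \<le> N v + N ((- c) *\<^sub>R w)"
    using N unfolding is_norm_def by blast
  moreover have "N ((- c) *\<^sub>R w) = \<bar>- c\<bar> * N w"
    using N unfolding is_norm_def by blast
  ultimately show ?thesis using \<open>0 \<le> c\<close> by simp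
qed

lemma compatible_norms_contraction:
  assumes "compatible_norms N MN" and "MN M \<le> s"
  shows "N (M *v v) \<le> s * N v"
proof -
  have "N (M *v v) \<le> MN M * N v" "0 \<le> N v"
    using assms(1) by (simp_all add: compatible_norms_def is_norm_def)
  with assms(2) show ?thesis by (meson mult_right_mono order_trans)
qed

subsection \<open>Positive matrices\<close>

lemma mult_mat_vec_nth:
  fixes J :: "'a::semiring_0 Matrix.mat"
  assumes "J \<in> carrier_mat n n" "v \<in> carrier_vec n" "i < n"
  shows "vec_index (J *\<^sub>v v) i = (\<Sum>j<n. J $$ (i, j) * vec_index v j)"
  using assms by (auto simp: Matrix.scalar_prod_def atLeast0LessThan intro!: sum.cong)

lemma eigenvalue_le_spectral_radius:
  assumes "M \<in> carrier_mat n n" and "eigenvalue M c"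
  shows "cmod c \<le> spectral_radius M"
  using assms spectral_radius_mem_max(2)[OF assms(1) eigenvalue_imp_nonzero_dim[OF assms]]
  by (auto simp: spectrum_def)

lemma spectral_radius_eigenvector:
  assumes M: "M \<in> carrier_mat n n" and n: "0 < n"
  obtains c v where "eigenvector M v c" "cmod c = spectral_radius M"
  using spectral_radius_mem_max(1)[OF assms]
  by (auto simp: spectrum_def eigenvalue_def)

text \<open>In the maximum norm weighted by \<epsilon>, \<open>J\<close> has operator norm below 1.
  Concretely, an eigenvector of an eigenvalue of largest modulus is examined at the index where the
  ratio of its modulus to \<epsilon> is maximal.\<close>

lemma spectral_radius_less_1_if_subinvariant:
  fixes J :: "real Matrix.mat" and \<epsilon> :: "nat \<Rightarrow> real"
  assumes J: "J \<in> carrier_mat n n" and n: "0 < n"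
    and nonneg: "\<And>i j. i < n \<Longrightarrow> j < n \<Longrightarrow> 0 \<le> J $$ (i, j)"
    and pos: "\<And>i. i < n \<Longrightarrow> 0 < \<epsilon> i"
    and less: "\<And>i. i < n \<Longrightarrow> (\<Sum>j<n. J $$ (i, j) * \<epsilon> j) < \<epsilon> i"
  shows "spectral_radius (map_mat complex_of_real J) < 1"
proof -
  define M where "M = map_mat complex_of_real J"
  have M: "M \<in> carrier_mat n n" using J by (simp add: M_def)
  obtain c v where ev: "eigenvector M v c" and c: "cmod c = spectral_radius M"
    using spectral_radius_eigenvector[OF M n] .
  have v: "v \<in> carrier_vec n" and v0: "v \<noteq> 0\<^sub>v n" and Mv: "M *\<^sub>v v = c \<cdot>\<^sub>v v"
    using ev M by (auto simp: eigenvector_def)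
  define r where "r i = cmod (vec_index v i) / \<epsilon> i" for i
  have "Max (r ` {..<n}) \<in> r ` {..<n}" using n by (intro Max_in) auto
  then obtain i where i: "i < n" and ri: "r i = Max (r ` {..<n})" by fastforce
  have r_le: "r j \<le> r i" if "j < n" for j
    unfolding ri using that by (intro Max_ge) auto
  have r_eq: "cmod (vec_index v j) = r j * \<epsilon> j" if "j < n" for j
    using pos[OF that] by (simp add: r_def)
  \<comment> \<open>A maximal ratio of 0 would make the eigenvector vanish. Positivity keeps the
    later inequality strict and allows cancellation.\<close>
  have ri0: "0 < r i"
  proof (rule ccontr)
    assume "\<not> 0 < r i"
    then have "vec_index v j = 0" if "j < n" for j
      using r_le[OF that] r_eq[OF that] pos[OF that]
        mult_nonpos_nonneg[of "r j" "\<epsilon> j"] by (metis less_eq_real_def not_less norm_le_zero_iff order_trans)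
    then have "v = 0\<^sub>v n" using v by (intro eq_vecI) auto
    with v0 show False by simp
  qed
  have "cmod c * (r i * \<epsilon> i) = cmod (vec_index (M *\<^sub>v v) i)"
    using i v Mv r_eq[OF i] by (simp add: norm_mult)
  also have "\<dots> = cmod (\<Sum>j<n. M $$ (i, j) * vec_index v j)"
    by (simp only: mult_mat_vec_nth[OF M v i])
  also have "\<dots> \<le> (\<Sum>j<n. J $$ (i, j) * (r i * \<epsilon> j))"
  proof (intro sum_norm_le)
    fix j assume "j \<in> {..<n}"
    then have j: "j < n" by simp
    have "cmod (M $$ (i, j) * vec_index v j) = J $$ (i, j) * (r j * \<epsilon> j)"
      using i j J nonneg r_eq[OF j] by (simp add: M_def norm_mult)
    also have "\<dots> \<le> J $$ (i, j) * (r i * \<epsilon> j)"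
      using i j nonneg r_le pos by (intro mult_left_mono mult_right_mono) (auto intro: less_imp_le)
    finally show "cmod (M $$ (i, j) * vec_index v j) \<le> J $$ (i, j) * (r i * \<epsilon> j)" .
  qed
  also have "\<dots> = r i * (\<Sum>j<n. J $$ (i, j) * \<epsilon> j)"
    by (simp add: sum_distrib_left mult_ac)
  also have "\<dots> < r i * \<epsilon> i"
    using less[OF i] ri0 by simp
  finally have "cmod c < 1"
    using mult_right_less_imp_less[of "cmod c" "r i * \<epsilon> i" 1] mult_pos_pos[OF ri0 pos[OF i]]
    by simp
  then show ?thesis by (simp add: c M_def)
qed

text \<open>A Perron vector is a Brouwer fixed point of the normalised action on the simplex.\<close>

lemma perron_vector_cart:
  fixes M :: "real^'n^'n"
  assumes pos: "\<And>i j. 0 < M $ i $ j"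
  obtains c v where "\<And>i. 0 < v $ i" "M *v v = c *\<^sub>R v"
proof -
  define S where "S = {v :: real^'n. (\<forall>i. 0 \<le> v $ i) \<and> (\<Sum>i\<in>UNIV. v $ i) = 1}"
  define s where "s v = (\<Sum>i\<in>UNIV. (M *v v) $ i)" for v :: "real^'n"
  \<comment> \<open>Strict positivity of \<open>M\<close> makes the image positive even where
    \<open>v\<close> has zeros, so the normalising sum \<open>s v\<close> never vanishes on the
    simplex.\<close>
  have pos_image: "0 < (M *v v) $ i" if "v \<in> S" for v i
  proof -
    have "\<exists>j. v $ j \<noteq> 0"
    proof (rule ccontr)
      assume "\<nexists>j. v $ j \<noteq> 0"
      with that show False by (simp add: S_def)
    qed
    then obtain j where "v $ j \<noteq> 0" ..
    with that have "0 < v $ j"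
      by (simp add: S_def order_less_le)
    then show ?thesis
      unfolding matrix_vector_mult_def using that pos
      by (auto simp: S_def less_imp_le intro!: sum_pos2[of _ j])
  qed
  have s: "0 < s v" if "v \<in> S" for v
    unfolding s_def by (intro sum_pos pos_image that) auto
  have "closed S"
    unfolding S_def
    by (intro closed_Collect_conj closed_Collect_all closed_Collect_le closed_Collect_eq continuous_intros)
  moreover have "bounded S"
  proof (rule boundedI)
    fix v assume "v \<in> S"
    then show "norm v \<le> 1"
      using norm_le_l1_cart[of v] by (simp add: S_def)
  qed
  ultimately have compact: "compact S" by (simp add: compact_eq_bounded_closed)
  have convex: "convex S"
    unfolding S_def convex_def
    by (auto simp: sum.distrib simp flip: sum_distrib_left)
  have "axis undefined 1 \<in> S"
    by (simp add: S_def axis_def)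
  then have nonempty: "S \<noteq> {}" by auto
  have "continuous_on S (\<lambda>v. (1 / s v) *\<^sub>R (M *v v))"
    using s unfolding s_def
    by (intro continuous_intros linear_continuous_on_compose[OF continuous_on_id] matrix_vector_mul_linear)
       (auto simp: less_le)
  moreover have "(\<lambda>v. (1 / s v) *\<^sub>R (M *v v)) \<in> S \<rightarrow> S"
  proof
    fix v assume v: "v \<in> S"
    then show "(1 / s v) *\<^sub>R (M *v v) \<in> S"
      using pos_image[OF v] s[OF v]
      by (auto simp: S_def less_imp_le s_def simp flip: sum_divide_distrib)
  qed
  ultimately obtain v where v: "v \<in> S" and fixp: "(1 / s v) *\<^sub>R (M *v v) = v"
    using brouwer[OF compact convex nonempty] by blast
  show thesis
  proof
    show "M *v v = s v *\<^sub>R v"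
      using s[OF v] by (subst (2) fixp[symmetric]) simp
    \<comment> \<open>The fixed point is a positive multiple of its own image, and that image is
      strictly positive.\<close>
    show "0 < v $ i" for i
      using pos_image[OF v, of i] s[OF v] by (subst fixp[symmetric]) simp
  qed
qed

text \<open>Transports \<open>perron_vector_cart\<close> along a bijection between an index type and
  the naturals below its cardinality; writing the dimension as \<open>CARD('n)\<close> makes such a
  type available.\<close>

lemma perron_vector:
  fixes J :: "real Matrix.mat"
  assumes J: "J \<in> carrier_mat CARD('n::finite) CARD('n)"
    and pos: "\<And>i j. i < CARD('n) \<Longrightarrow> j < CARD('n) \<Longrightarrow> 0 < J $$ (i, j)"
  obtains c v where "v \<in> carrier_vec CARD('n)" "\<And>i. i < CARD('n) \<Longrightarrow> 0 < vec_index v i"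
    "J *\<^sub>v v = c \<cdot>\<^sub>v v"
proof -
  obtain \<phi> :: "'n \<Rightarrow> nat" where \<phi>: "bij_betw \<phi> UNIV {..<CARD('n)}"
    using ex_bij_betw_finite_nat[of "UNIV :: 'n set"] by (auto simp: atLeast0LessThan)
  define \<psi> where "\<psi> = inv_into UNIV \<phi>"
  have \<phi>_less: "\<phi> a < CARD('n)" for a
    using \<phi> by (auto simp: bij_betw_def)
  have \<psi>\<phi>: "\<psi> (\<phi> a) = a" for a
    using \<phi> by (simp add: \<psi>_def bij_betw_def inv_into_f_f)
  have \<phi>\<psi>: "\<phi> (\<psi> i) = i" if "i < CARD('n)" for i
    using \<phi> that by (simp add: \<psi>_def bij_betw_def f_inv_into_f)
  obtain c and u :: "real^'n" where u: "\<And>a. 0 < u $ a"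
    and eig: "(\<chi> a b. J $$ (\<phi> a, \<phi> b)) *v u = c *\<^sub>R u"
    by (rule perron_vector_cart[of "\<chi> a b. J $$ (\<phi> a, \<phi> b)"]) (use pos \<phi>_less in auto)
  define v where "v = Matrix.vec CARD('n) (\<lambda>i. u $ \<psi> i)"
  have v: "v \<in> carrier_vec CARD('n)" by (simp add: v_def)
  show thesis
  proof
    show "v \<in> carrier_vec CARD('n)" by (rule v)
    show "0 < vec_index v i" if "i < CARD('n)" for i
      using that u by (simp add: v_def)
    show "J *\<^sub>v v = c \<cdot>\<^sub>v v"
    proof (intro eq_vecI)
      fix i assume "i < dim_vec (c \<cdot>\<^sub>v v)"
      then have i: "i < CARD('n)" by (simp add: v_def)
      have "vec_index (J *\<^sub>v v) i = (\<Sum>j<CARD('n). J $$ (i, j) * u $ \<psi> j)"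
        unfolding mult_mat_vec_nth[OF J v i] by (simp add: v_def)
      also have "\<dots> = (\<Sum>b\<in>UNIV. J $$ (i, \<phi> b) * u $ b)"
        by (subst sum.reindex_bij_betw[OF \<phi>, symmetric]) (simp add: \<psi>\<phi>)
      also have "\<dots> = ((\<chi> a b. J $$ (\<phi> a, \<phi> b)) *v u) $ \<psi> i"
        by (simp add: matrix_vector_mult_def \<phi>\<psi>[OF i])
      finally show "vec_index (J *\<^sub>v v) i = vec_index (c \<cdot>\<^sub>v v) i"
        using i by (simp add: eig v_def)
    qed (use J v in auto)
  qed
qed

text \<open>Dominating \<open>t 0\<close> by a Perron vector avoids the polynomial factor that a Jordan form bound
  would give.\<close>

lemma positive_recursion_growth:
  fixes J :: "real Matrix.mat" and t :: "nat \<Rightarrow> real Matrix.vec"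
  assumes J: "J \<in> carrier_mat CARD('n::finite) CARD('n)"
    and pos: "\<And>i j. i < CARD('n) \<Longrightarrow> j < CARD('n) \<Longrightarrow> 0 < J $$ (i, j)"
    and t: "\<And>k. t k \<in> carrier_vec CARD('n)"
    and step: "\<And>k. t (Suc k) \<le> J *\<^sub>v t k"
  obtains C where
    "\<And>k i. i < CARD('n) \<Longrightarrow> vec_index (t k) i \<le> C * spectral_radius (map_mat complex_of_real J) ^ k"
proof -
  let ?n = "CARD('n)" and ?\<rho> = "spectral_radius (map_mat complex_of_real J)"
  obtain c v where v: "v \<in> carrier_vec ?n" and v_pos: "\<And>i. i < ?n \<Longrightarrow> 0 < vec_index v i"
    and eig: "J *\<^sub>v v = c \<cdot>\<^sub>v v"
    using perron_vector[OF J pos] by blast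
  have n: "0 < ?n" by simp
  have Jv: "(\<Sum>j<?n. J $$ (i, j) * vec_index v j) = c * vec_index v i" if "i < ?n" for i
    using mult_mat_vec_nth[OF J v that] eig v that by simp
  \<comment> \<open>Row 0 of the eigenvalue equation fixes the sign of \<open>c\<close>, so that
    powers of \<open>c\<close> can be compared with powers of the spectral radius.\<close>
  have "0 < (\<Sum>j<?n. J $$ (0, j) * vec_index v j)"
    using pos v_pos n by (intro sum_pos) (auto simp: lessThan_empty_iff)
  then have c: "0 < c"
    using Jv[OF n] v_pos[OF n] by (simp add: zero_less_mult_iff)
  \<comment> \<open>Read over the complex numbers, the Perron pair shows that \<open>c\<close> is an
    eigenvalue, hence at most the spectral radius.\<close>
  have "eigenvector (map_mat complex_of_real J) (map_vec complex_of_real v) (complex_of_real c)"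
    unfolding eigenvector_def
  proof (intro conjI)
    have "vec_index (map_vec complex_of_real v) 0 \<noteq> vec_index (0\<^sub>v ?n) 0"
      using v v_pos[OF n] by simp
    then show "map_vec complex_of_real v \<noteq> 0\<^sub>v (dim_row (map_mat complex_of_real J))"
      using J by auto
    show "map_mat complex_of_real J *\<^sub>v map_vec complex_of_real v =
        complex_of_real c \<cdot>\<^sub>v map_vec complex_of_real v"
      using of_real_hom.mult_mat_vec_hom[OF J v, where 'a = complex] eig
      by (simp add: of_real_hom.vec_hom_smult)
  qed (use J v in auto)
  then have "cmod (complex_of_real c) \<le> ?\<rho>"
    using J by (intro eigenvalue_le_spectral_radius[of _ ?n]) (auto simp: eigenvalue_def)
  then have c_le: "c \<le> ?\<rho>" using c by simp
  \<comment> \<open>A sum of nonnegative ratios dominates each of them, so \<open>t 0\<close> lies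
    entrywise below \<open>D\<close> times \<open>v\<close>.\<close>
  define D where "D = (\<Sum>i<?n. \<bar>vec_index (t 0) i\<bar> / vec_index v i)"
  have D0: "0 \<le> D"
    unfolding D_def using v_pos by (intro sum_nonneg) (auto intro: divide_nonneg_pos)
  have bound: "vec_index (t k) i \<le> D * c ^ k * vec_index v i" if "i < ?n" for k i
    using that
  proof (induction k arbitrary: i)
    case 0
    have "\<bar>vec_index (t 0) i\<bar> / vec_index v i \<le> D"
      unfolding D_def using v_pos 0
      by (intro member_le_sum) (auto intro: divide_nonneg_pos)
    then show ?case
      using v_pos[OF 0] by (simp add: pos_divide_le_eq)
  next
    case (Suc k)
    have "vec_index (t (Suc k)) i \<le> vec_index (J *\<^sub>v t k) i"
      using step[of k] J Suc.prems by (auto simp: less_eq_vec_def)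
    also have "\<dots> = (\<Sum>j<?n. J $$ (i, j) * vec_index (t k) j)"
      by (rule mult_mat_vec_nth[OF J t Suc.prems])
    also have "\<dots> \<le> (\<Sum>j<?n. J $$ (i, j) * (D * c ^ k * vec_index v j))"
      using Suc pos by (intro sum_mono mult_left_mono) (auto intro: less_imp_le)
    also have "\<dots> = D * c ^ k * (\<Sum>j<?n. J $$ (i, j) * vec_index v j)"
      by (simp add: sum_distrib_left mult_ac)
    also have "\<dots> = D * c ^ Suc k * vec_index v i"
      by (simp add: Jv[OF Suc.prems])
    finally show ?case .
  qed
  \<comment> \<open>Replacing the entry of \<open>v\<close> by the sum of all entries makes the
    constant independent of \<open>i\<close>.\<close>
  define C where "C = D * (\<Sum>i<?n. vec_index v i)"
  have "vec_index (t k) i \<le> C * ?\<rho> ^ k" if i: "i < ?n" for k i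
  proof -
    have "vec_index v i \<le> (\<Sum>i<?n. vec_index v i)"
      using i v_pos by (intro member_le_sum) (auto intro: less_imp_le)
    then have "D * c ^ k * vec_index v i \<le> D * ?\<rho> ^ k * (\<Sum>i<?n. vec_index v i)"
      using D0 c c_le v_pos[OF i] by (intro mult_mono power_mono mult_nonneg_nonneg) auto
    with bound[OF i, of k] show ?thesis by (simp add: C_def mult_ac)
  qed
  then show thesis using that by blast
qed

subsection \<open>The comparison system\<close>

theorem theorem1:
  fixes E :: "('n::finite \<times> 'n) set"
    and Au Bu :: "real^'n^'n"
    and \<pi>\<^sub>r \<pi>\<^sub>c :: "real^'n"
    and A B Ainf Binf I\<^sub>n\<^sub>p :: "real^('n \<times> 'p::finite)^('n \<times> 'p)"
    and f :: "'n \<Rightarrow> real^'p \<Rightarrow> real"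
    and grad :: "'n \<Rightarrow> real^'p \<Rightarrow> real^'p"
    and gradf :: "nat \<Rightarrow> real^('n \<times> 'p)"
    and F :: "real^'p \<Rightarrow> real"
    and xstar :: "real^'p"
    and x y :: "nat \<Rightarrow> real^('n \<times> 'p)"
    and N\<^sub>A N\<^sub>B :: "real^('n \<times> 'p) \<Rightarrow> real"
    and M\<^sub>A M\<^sub>B :: "real^('n \<times> 'p)^('n \<times> 'p) \<Rightarrow> real"
    and n \<alpha> \<beta> \<eta> \<sigma>\<^sub>A \<sigma>\<^sub>B h g l m \<theta> lam :: real
    and a\<^sub>1 a\<^sub>2 a\<^sub>3 a\<^sub>4 a\<^sub>5 a\<^sub>6 a\<^sub>7 a\<^sub>8 a\<^sub>9 :: real
    and t :: "nat \<Rightarrow> real Matrix.vec"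
    and J :: "real Matrix.mat"
  assumes n_def: "n = real CARD('n)" and n_ge_2: "2 \<le> CARD('n)"
    \<comment> \<open>graph and weights\<close>
    and connected: "strongly_connected E"
    and Au_pos: "\<And>i j. j \<in> in_neighbors E i \<Longrightarrow> 0 < Au $ i $ j"
    and Au_zero: "\<And>i j. j \<notin> in_neighbors E i \<Longrightarrow> Au $ i $ j = 0"
    and Au_row: "\<And>i. (\<Sum>j\<in>UNIV. Au $ i $ j) = 1"
    and Bu_pos: "\<And>i j. i \<in> out_neighbors E j \<Longrightarrow> 0 < Bu $ i $ j"
    and Bu_zero: "\<And>i j. i \<notin> out_neighbors E j \<Longrightarrow> Bu $ i $ j = 0"
    and Bu_col: "\<And>j. (\<Sum>i\<in>UNIV. Bu $ i $ j) = 1"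
    and \<pi>\<^sub>r: "\<pi>\<^sub>r v* Au = \<pi>\<^sub>r" "\<pi>\<^sub>r \<bullet> 1 = 1"
    and \<pi>\<^sub>c: "Bu *v \<pi>\<^sub>c = \<pi>\<^sub>c" "1 \<bullet> \<pi>\<^sub>c = 1"
    and I_def: "I\<^sub>n\<^sub>p = mat 1"
    and A_def: "A = kron Au (mat 1)"
    and B_def: "B = kron Bu (mat 1)"
    and Ainf_def: "Ainf = kron (outer_prod 1 \<pi>\<^sub>r) (mat 1)"
    and Binf_def: "Binf = kron (outer_prod \<pi>\<^sub>c 1) (mat 1)"
    \<comment> \<open>objective functions\<close>
    and \<alpha>\<beta>: "0 < \<alpha>" "0 < \<beta>"
    and gradient: "\<And>i z. GDERIV (f i) z :> grad i z"
    and smooth: "\<And>i z w. norm (grad i z - grad i w) \<le> \<beta> * norm (z - w)"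
    and strongly_convex:
      "\<And>i z w. f i z - f i w \<le> grad i z \<bullet> (z - w) - \<alpha> / 2 * (norm (z - w))\<^sup>2"
    and F_def: "F = (\<lambda>z. 1 / n * (\<Sum>i\<in>UNIV. f i z))"
    and minimizer: "is_arg_min F (\<lambda>_. True) xstar"
    \<comment> \<open>algorithm\<close>
    and gradf_def: "gradf = (\<lambda>k. stack (\<lambda>i. grad i (block i (x k))))"
    and y_0: "y 0 = gradf 0"
    and x_Suc: "\<And>k. x (Suc k) = A *v x k - \<eta> *\<^sub>R y k"
    and y_Suc: "\<And>k. y (Suc k) = B *v (y k + gradf (Suc k) - gradf k)"
    \<comment> \<open>norms\<close>
    and norm_A: "compatible_norms N\<^sub>A M\<^sub>A"
    and norm_B: "compatible_norms N\<^sub>B M\<^sub>B"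
    and \<sigma>\<^sub>A: "0 < \<sigma>\<^sub>A" "\<sigma>\<^sub>A < 1" "M\<^sub>A (A - Ainf) \<le> \<sigma>\<^sub>A"
    and \<sigma>\<^sub>B: "0 < \<sigma>\<^sub>B" "\<sigma>\<^sub>B < 1" "M\<^sub>B (B - Binf) \<le> \<sigma>\<^sub>B"
    and consts_pos: "0 < h" "0 < g" "0 < l" "0 < m"
    and h: "\<And>v. norm v \<le> h * N\<^sub>B v"
    and g: "\<And>v. norm v \<le> g * N\<^sub>A v"
    and l: "\<And>v. N\<^sub>B v \<le> l * norm v"
    and m: "\<And>v. N\<^sub>A v \<le> m * norm v"
    \<comment> \<open>the comparison system\<close>
    and \<theta>_def: "\<theta> = \<pi>\<^sub>r \<bullet> \<pi>\<^sub>c"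
    and lam_def: "lam = max \<bar>1 - \<alpha> * n * \<eta> * \<theta>\<bar> \<bar>1 - \<beta> * n * \<eta> * \<theta>\<bar>"
    and a\<^sub>1_def: "a\<^sub>1 = m * g * \<beta> * spectral_norm (I\<^sub>n\<^sub>p - Ainf) * spectral_norm Binf"
    and a\<^sub>2_def: "a\<^sub>2 = m * \<beta> * spectral_norm (I\<^sub>n\<^sub>p - Ainf) * spectral_norm Binf"
    and a\<^sub>3_def: "a\<^sub>3 = m * h * spectral_norm (I\<^sub>n\<^sub>p - Ainf)"
    and a\<^sub>4_def: "a\<^sub>4 = n * \<beta> * g * \<theta>"
    and a\<^sub>5_def: "a\<^sub>5 = h * spectral_norm Ainf"
    and a\<^sub>6_def: "a\<^sub>6 = g * \<sigma>\<^sub>B * l * \<beta> * spectral_norm (A - I\<^sub>n\<^sub>p)"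
    and a\<^sub>7_def: "a\<^sub>7 = g * \<sigma>\<^sub>B * l * \<beta>\<^sup>2 * spectral_norm Binf"
    and a\<^sub>8_def: "a\<^sub>8 = \<sigma>\<^sub>B * l * \<beta>\<^sup>2 * spectral_norm Binf"
    and a\<^sub>9_def: "a\<^sub>9 = h * \<sigma>\<^sub>B * l * \<beta>"
    and t_def: "t = (\<lambda>k. vec_of_list
      [N\<^sub>A (x k - Ainf *v x k),
       norm (Ainf *v x k - kron_vec 1 xstar),
       N\<^sub>B (y k - Binf *v y k)])"
    and J_def: "J = mat_of_rows_list 3
      [[\<sigma>\<^sub>A + a\<^sub>1 * \<eta>, a\<^sub>2 * \<eta>, a\<^sub>3 * \<eta>],
       [a\<^sub>4 * \<eta>, lam, a\<^sub>5 * \<eta>],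
       [a\<^sub>6 + a\<^sub>7 * \<eta>, a\<^sub>8 * \<eta>, \<sigma>\<^sub>B + a\<^sub>9 * \<eta>]]"
  shows "(0 < \<eta> \<and> \<eta> < 2 / (n * \<beta> * \<theta>) \<longrightarrow> (\<forall>k. t (Suc k) \<le> J *\<^sub>v t k)) \<and>
    (\<forall>\<epsilon>\<^sub>1 \<epsilon>\<^sub>2 \<epsilon>\<^sub>3 :: real.
       0 < \<epsilon>\<^sub>1 \<and> 0 < \<epsilon>\<^sub>2 \<and> 0 < \<epsilon>\<^sub>3 \<and>
       \<epsilon>\<^sub>1 < (1 - \<sigma>\<^sub>B) * \<epsilon>\<^sub>3 / a\<^sub>6 \<and>
       \<epsilon>\<^sub>2 > (a\<^sub>4 * \<epsilon>\<^sub>1 + a\<^sub>5 * \<epsilon>\<^sub>3) / (\<alpha> * n * \<theta>) \<and>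
       0 < \<eta> \<and>
       \<eta> < Min {\<epsilon>\<^sub>1 * (1 - \<sigma>\<^sub>A) / (a\<^sub>1 * \<epsilon>\<^sub>1 + a\<^sub>2 * \<epsilon>\<^sub>2 + a\<^sub>3 * \<epsilon>\<^sub>3),
                 ((1 - \<sigma>\<^sub>B) * \<epsilon>\<^sub>3 - \<epsilon>\<^sub>1 * a\<^sub>6) / (a\<^sub>7 * \<epsilon>\<^sub>1 + a\<^sub>8 * \<epsilon>\<^sub>2 + a\<^sub>9 * \<epsilon>\<^sub>3),
                 1 / (n * \<beta> * \<theta>)}
       \<longrightarrow>
       spectral_radius (map_mat complex_of_real J) < 1 \<and>
       (\<lambda>k. norm (x k - kron_vec 1 xstar)) \<longlonglongrightarrow> 0 \<and>
       (\<lambda>k. norm (x k - kron_vec 1 xstar))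
         \<in> O(\<lambda>k. spectral_radius (map_mat complex_of_real J) ^ k))"
proof -
  let ?sI = "spectral_norm (I\<^sub>n\<^sub>p - Ainf)" and ?sA = "spectral_norm Ainf" and ?sB = "spectral_norm Binf"
    and ?sD = "spectral_norm (A - I\<^sub>n\<^sub>p)"
  have norms: "is_norm N\<^sub>A" "is_norm N\<^sub>B"
    using norm_A norm_B by (simp_all add: compatible_norms_def)
  then have N_nonneg: "0 \<le> N\<^sub>A v" "0 \<le> N\<^sub>B v" for v
    by (simp_all add: is_norm_def)
  have n_pos: "0 < n" by (simp add: n_def)
  \<comment> \<open>The sign of \<theta> comes from the step-size bound: for \<theta> \<le> 0 the
    quotient is at most 0 (division by zero gives 0), contradicting 0 < \<eta>. Part (1) uses
    \<open>c = 2\<close>, part (2) uses \<open>c = 1\<close>.\<close>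
  have \<theta>_pos: "0 < \<theta>" if "0 < \<eta>" "\<eta> < c / (n * \<beta> * \<theta>)" "0 < c" for c
  proof -
    have "0 < c / (n * \<beta> * \<theta>)" using that by linarith
    moreover have "0 < n * \<beta>" using n_pos \<alpha>\<beta> by simp
    ultimately show ?thesis
      using \<open>0 < c\<close> by (simp add: zero_less_divide_iff zero_less_mult_iff[of "n * \<beta>" \<theta>])
  qed

  \<comment> \<open>Algebra of the limit matrices\<close>
  have "Au *v 1 = 1"
    using Au_row by (simp add: Finite_Cartesian_Product.vec_eq_iff matrix_vector_mult_def)
  then have A_mult: "A ** Ainf = Ainf" "Ainf ** A = Ainf" "Ainf ** Ainf = Ainf"
    using \<pi>\<^sub>r unfolding A_def Ainf_def
    by (simp_all add: kron_mult mult_outer_prod[of Au] outer_prod_mult_right[of _ _ Au] outer_prod_idem)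
  have "1 v* Bu = 1"
    using Bu_col by (simp add: Finite_Cartesian_Product.vec_eq_iff vector_matrix_mult_def)
  then have B_mult: "B ** Binf = Binf" "Binf ** B = Binf" "Binf ** Binf = Binf"
    using \<pi>\<^sub>c unfolding B_def Binf_def
    by (simp_all add: kron_mult mult_outer_prod[of Bu] outer_prod_mult_right[of _ _ Bu] outer_prod_idem)
  have A_vec: "A *v (Ainf *v z) = Ainf *v z" "Ainf *v (A *v z) = Ainf *v z"
    "Ainf *v (Ainf *v z) = Ainf *v z" for z
    by (simp_all add: matrix_vector_mul_assoc A_mult)
  have B_vec: "B *v (Binf *v z) = Binf *v z" "Binf *v (B *v z) = Binf *v z"
    "Binf *v (Binf *v z) = Binf *v z" for z
    by (simp_all add: matrix_vector_mul_assoc B_mult)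
  have Ainf_vec: "Ainf *v z = kron_vec 1 (\<Sum>i\<in>UNIV. \<pi>\<^sub>r $ i *\<^sub>R block i z)" for z
    unfolding Ainf_def by (rule kron_outer_prod_mult_vec)
  have Binf_vec: "Binf *v z = kron_vec \<pi>\<^sub>c (\<Sum>i\<in>UNIV. block i z)" for z
    unfolding Binf_def by (simp add: kron_outer_prod_mult_vec)

  \<comment> \<open>The summed objective and its minimizer\<close>
  define G where "G z = (\<Sum>i\<in>UNIV. grad i z)" for z
  have scs: "strongly_convex_smooth (f i) (grad i) \<alpha> \<beta>" for i
    by standard (rule gradient smooth strongly_convex)+
  then interpret S: strongly_convex_smooth "\<lambda>z. \<Sum>i\<in>UNIV. f i z" G "n * \<alpha>" "n * \<beta>"
    using strongly_convex_smooth_sum[of UNIV f grad \<alpha> \<beta>] by (simp add: G_def[abs_def] n_def)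
  have "(\<Sum>i\<in>UNIV. f i xstar) \<le> (\<Sum>i\<in>UNIV. f i w)" for w
    using minimizer n_pos by (simp add: is_arg_min_linorder F_def divide_le_cancel)
  then have G_xstar: "G xstar = 0"
    using S.grad by (intro GDERIV_minimum_eq_0[where z = xstar])
  \<comment> \<open>A nonzero vector supplies the two distinct points needed for \<alpha> \<le>
    \<beta>.\<close>
  have "axis undefined 1 \<noteq> (0 :: real^'p)"
    by (simp add: axis_eq_0_iff)
  then have \<alpha>_le_\<beta>: "\<alpha> \<le> \<beta>"
    using S.convexity_le_smoothness n_pos by fastforce

  \<comment> \<open>Error vectors and bounds on the iterates\<close>
  have grad_lipschitz: "norm (stack (\<lambda>i. grad i (block i z)) - stack (\<lambda>i. grad i (block i w)))
      \<le> \<beta> * norm (z - w)" for z w :: "real^('n \<times> 'p)"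
    using smooth \<alpha>\<beta> by (intro norm_le_blockwise) (auto simp: block_diff block_stack)
  define e where "e k = x k - Ainf *v x k" for k
  define d where "d k = Ainf *v x k - kron_vec 1 xstar" for k
  define r where "r k = y k - Binf *v y k" for k

  \<comment> \<open>\<open>Binf\<close> absorbs \<open>B\<close>, so the gradient increments
    telescope from \<open>y 0 = gradf 0\<close>.\<close>
  have Binf_y: "Binf *v y k = Binf *v gradf k" for k
  proof (induction k)
    case (Suc k)
    then show ?case
      by (simp add: y_Suc B_vec matrix_vector_mult_diff_distrib matrix_vector_right_distrib)
  qed (simp add: y_0)
  have norm_x: "norm (x k - kron_vec 1 xstar) \<le> g * N\<^sub>A (e k) + norm (d k)" for k
  proof -
    have "x k - kron_vec 1 xstar = e k + d k" by (simp add: e_def d_def)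
    then show ?thesis using norm_triangle_ineq[of "e k" "d k"] g[of "e k"] by simp
  qed
  have norm_y: "norm (y k) \<le> ?sB * \<beta> * (g * N\<^sub>A (e k) + norm (d k)) + h * N\<^sub>B (r k)" for k
  proof -
    \<comment> \<open>The gradients at the consensus optimum sum to zero, so \<open>Binf\<close>
      annihilates \<open>gs\<close>; subtracting it brings in the Lipschitz bound.\<close>
    define gs where "gs = stack (\<lambda>i. grad i (block i (kron_vec (1 :: real^'n) xstar)))"
    have "Binf *v gs = 0"
      using G_xstar by (simp add: Binf_vec gs_def block_stack block_kron_vec G_def)
        (simp add: kron_vec_def Finite_Cartesian_Product.vec_eq_iff)
    then have "Binf *v y k = Binf *v (gradf k - gs)"
      by (simp add: Binf_y matrix_vector_mult_diff_distrib)
    then have "norm (Binf *v y k) \<le> ?sB * norm (gradf k - gs)"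
      by (simp add: norm_mult_le_spectral_norm)
    also have "\<dots> \<le> ?sB * (\<beta> * norm (x k - kron_vec 1 xstar))"
      unfolding gs_def gradf_def by (intro mult_left_mono grad_lipschitz spectral_norm_nonneg)
    also have "\<dots> \<le> ?sB * (\<beta> * (g * N\<^sub>A (e k) + norm (d k)))"
      using \<alpha>\<beta> by (intro mult_left_mono norm_x spectral_norm_nonneg) auto
    finally show ?thesis
      using norm_triangle_ineq[of "Binf *v y k" "r k"] h[of "r k"] by (simp add: r_def)
  qed

  \<comment> \<open>The three error recursions\<close>
  have row1: "N\<^sub>A (e (Suc k)) \<le> (\<sigma>\<^sub>A + a\<^sub>1 * \<eta>) * N\<^sub>A (e k) + a\<^sub>2 * \<eta> * norm (d k) + a\<^sub>3 * \<eta> * N\<^sub>B (r k)"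
    if \<eta>: "0 < \<eta>" for k
  proof -
    have "e (Suc k) = (A - Ainf) *v e k - \<eta> *\<^sub>R ((I\<^sub>n\<^sub>p - Ainf) *v y k)"
      by (simp add: e_def x_Suc I_def matrix_mult_diff_scaleR_vec matrix_vector_mult_diff_distrib
          matrix_vector_mult_diff_rdistrib A_vec algebra_simps)
    then have "N\<^sub>A (e (Suc k)) \<le> N\<^sub>A ((A - Ainf) *v e k) + \<eta> * N\<^sub>A ((I\<^sub>n\<^sub>p - Ainf) *v y k)"
      using is_norm_diff_scaleR[OF norms(1)] \<eta> by simp
    \<comment> \<open>The consensus error stays in \<open>N\<^sub>A\<close>, where
      \<open>A - Ainf\<close> contracts; the \<open>y\<close> term passes to the Euclidean norm at
      the cost of \<open>m\<close>, so that \<open>norm_y\<close> applies.\<close>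
    also have "\<dots> \<le> \<sigma>\<^sub>A * N\<^sub>A (e k) + \<eta> * (m * (?sI * norm (y k)))"
    proof (intro add_mono mult_left_mono)
      show "N\<^sub>A ((A - Ainf) *v e k) \<le> \<sigma>\<^sub>A * N\<^sub>A (e k)"
        by (rule compatible_norms_contraction[OF norm_A \<sigma>\<^sub>A(3)])
      show "N\<^sub>A ((I\<^sub>n\<^sub>p - Ainf) *v y k) \<le> m * (?sI * norm (y k))"
        using m consts_pos norm_mult_le_spectral_norm
        by (meson less_imp_le mult_left_mono order_trans)
    qed (use \<eta> in auto)
    also have "\<dots> \<le> \<sigma>\<^sub>A * N\<^sub>A (e k)
        + \<eta> * (m * (?sI * (?sB * \<beta> * (g * N\<^sub>A (e k) + norm (d k)) + h * N\<^sub>B (r k))))"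
      using \<eta> consts_pos by (intro add_left_mono mult_left_mono norm_y spectral_norm_nonneg) auto
    finally show ?thesis
      by (simp add: a\<^sub>1_def a\<^sub>2_def a\<^sub>3_def algebra_simps)
  qed

  have row2: "norm (d (Suc k)) \<le> a\<^sub>4 * \<eta> * N\<^sub>A (e k) + lam * norm (d k) + a\<^sub>5 * \<eta> * N\<^sub>B (r k)"
    if \<eta>: "0 < \<eta>" and \<theta>: "0 < \<theta>" for k
  proof -
    define c where "c = (\<Sum>i\<in>UNIV. \<pi>\<^sub>r $ i *\<^sub>R block i (x k))"
    define q where "q = (\<Sum>i\<in>UNIV. grad i (block i (x k)))"
    let ?s = "\<eta> * \<theta>"
    have d_c: "d k = kron_vec 1 (c - xstar)"
      by (simp add: d_def c_def Ainf_vec kron_vec_diff_right)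
    have e_block: "block i (e k) = block i (x k) - c" for i
      by (simp add: e_def block_diff Ainf_vec block_kron_vec c_def)
    \<comment> \<open>Averaging the blocks \<open>\<pi>\<^sub>c $ i *\<^sub>R q\<close> with weights
      \<open>\<pi>\<^sub>r\<close> produces the factor \<theta>.\<close>
    have AB: "Ainf *v (Binf *v y k) = kron_vec 1 (\<theta> *\<^sub>R q)"
      unfolding Binf_y
      by (simp add: Ainf_vec Binf_vec block_kron_vec gradf_def block_stack q_def \<theta>_def
          inner_vec_def scaleR_sum_left)
    have "Ainf *v x (Suc k) = Ainf *v x k - \<eta> *\<^sub>R (Ainf *v (Binf *v y k)) - \<eta> *\<^sub>R (Ainf *v r k)"
      by (simp add: x_Suc matrix_mult_diff_scaleR_vec A_vec r_def matrix_vector_mult_diff_distrib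
          algebra_simps)
    \<comment> \<open>Three contributions: an exact gradient step at the average \<open>c\<close>,
      compared with the stationary point \<open>xstar\<close>; the error from evaluating gradients
      at local points; and the tracking error \<open>r k\<close>.\<close>
    then have "d (Suc k) = kron_vec 1 ((c - ?s *\<^sub>R G c) - (xstar - ?s *\<^sub>R G xstar))
        + kron_vec 1 (?s *\<^sub>R (G c - q)) - \<eta> *\<^sub>R (Ainf *v r k)"
      unfolding AB
      by (simp add: d_def Ainf_vec[of "x k"] c_def[symmetric] G_xstar kron_vec_diff_right
          kron_vec_add_right kron_vec_scaleR_right algebra_simps)
    then have "norm (d (Suc k)) \<le> norm (kron_vec (1 :: real^'n) ((c - ?s *\<^sub>R G c) - (xstar - ?s *\<^sub>R G xstar)))
        + norm (kron_vec (1 :: real^'n) (?s *\<^sub>R (G c - q))) + norm (\<eta> *\<^sub>R (Ainf *v r k))"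
      by (metis (no_types, lifting) add_right_mono norm_triangle_ineq norm_triangle_ineq4 order_trans)
    moreover have "norm (kron_vec (1 :: real^'n) ((c - ?s *\<^sub>R G c) - (xstar - ?s *\<^sub>R G xstar))) \<le> lam * norm (d k)"
    proof -
      \<comment> \<open>With step length \<eta> \<theta> and constants \<open>n * \<alpha>\<close>,
        \<open>n * \<beta>\<close>, the contraction factor is exactly \<open>lam\<close>.\<close>
      have "norm ((c - ?s *\<^sub>R G c) - (xstar - ?s *\<^sub>R G xstar)) \<le> lam * norm (c - xstar)"
        using S.gradient_step_contraction[of c ?s xstar] by (simp only: lam_def mult_ac)
      then have "sqrt CARD('n) * norm ((c - ?s *\<^sub>R G c) - (xstar - ?s *\<^sub>R G xstar))
          \<le> sqrt CARD('n) * (lam * norm (c - xstar))"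
        by (rule mult_left_mono) simp
      then show ?thesis
        by (simp only: norm_kron_vec_1 d_c mult_ac)
    qed
    \<comment> \<open>One root of \<open>n\<close> comes from replicating a vector over the agents,
      the other from summing block norms; their product is the \<open>n\<close> in
      \<open>a\<^sub>4\<close>.\<close>
    moreover have "norm (kron_vec (1 :: real^'n) (?s *\<^sub>R (G c - q))) \<le> a\<^sub>4 * \<eta> * N\<^sub>A (e k)"
    proof -
      have "norm (G c - q) \<le> (\<Sum>i\<in>UNIV. \<beta> * norm (block i (e k)))"
        unfolding G_def q_def sum_subtractf[symmetric] e_block
        using smooth by (intro sum_norm_le) (metis norm_minus_commute)
      also have "\<dots> \<le> \<beta> * (sqrt n * norm (e k))"
        using \<alpha>\<beta> sum_norm_block_le[of "e k"] by (simp add: n_def flip: sum_distrib_left)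
      also have "\<dots> \<le> \<beta> * (sqrt n * (g * N\<^sub>A (e k)))"
        using \<alpha>\<beta> n_pos g by (intro mult_left_mono) auto
      finally have "sqrt n * (?s * norm (G c - q)) \<le> sqrt n * (?s * (\<beta> * (sqrt n * (g * N\<^sub>A (e k)))))"
        using \<eta> \<theta> n_pos by (intro mult_left_mono) auto
      also have "\<dots> = (sqrt n * sqrt n) * \<beta> * g * \<theta> * \<eta> * N\<^sub>A (e k)"
        by (simp only: mult_ac)
      also have "\<dots> = a\<^sub>4 * \<eta> * N\<^sub>A (e k)"
        using n_pos by (simp add: a\<^sub>4_def)
      finally show ?thesis
        using \<eta> \<theta> by (simp add: norm_kron_vec_1 n_def)
    qed
    moreover have "norm (\<eta> *\<^sub>R (Ainf *v r k)) \<le> a\<^sub>5 * \<eta> * N\<^sub>B (r k)"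
    proof -
      have "norm (Ainf *v r k) \<le> ?sA * (h * N\<^sub>B (r k))"
        by (meson h mult_left_mono norm_mult_le_spectral_norm order_trans spectral_norm_nonneg)
      then have "\<eta> * norm (Ainf *v r k) \<le> \<eta> * (?sA * (h * N\<^sub>B (r k)))"
        using \<eta> by (intro mult_left_mono) auto
      then show ?thesis using \<eta> by (simp add: a\<^sub>5_def mult_ac)
    qed
    ultimately show ?thesis by linarith
  qed

  have row3: "N\<^sub>B (r (Suc k)) \<le> (a\<^sub>6 + a\<^sub>7 * \<eta>) * N\<^sub>A (e k) + a\<^sub>8 * \<eta> * norm (d k) + (\<sigma>\<^sub>B + a\<^sub>9 * \<eta>) * N\<^sub>B (r k)"
    if \<eta>: "0 < \<eta>" for k
  proof -
    have "norm (x (Suc k) - x k) \<le> norm ((A - I\<^sub>n\<^sub>p) *v e k) + \<eta> * norm (y k)"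
    proof -
      \<comment> \<open>Both \<open>A\<close> and the identity fix \<open>Ainf *v x k\<close>, so
        \<open>A - I\<^sub>n\<^sub>p\<close> sees only the consensus error.\<close>
      have "x (Suc k) - x k = (A - I\<^sub>n\<^sub>p) *v e k - \<eta> *\<^sub>R y k"
        by (simp add: e_def x_Suc I_def matrix_vector_mult_diff_distrib
            matrix_vector_mult_diff_rdistrib A_vec)
      then show ?thesis
        using norm_triangle_ineq4[of "(A - I\<^sub>n\<^sub>p) *v e k" "\<eta> *\<^sub>R y k"] \<eta> by simp
    qed
    also have "\<dots> \<le> ?sD * (g * N\<^sub>A (e k))
        + \<eta> * (?sB * \<beta> * (g * N\<^sub>A (e k) + norm (d k)) + h * N\<^sub>B (r k))"
    proof (intro add_mono mult_left_mono norm_y)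
      show "norm ((A - I\<^sub>n\<^sub>p) *v e k) \<le> ?sD * (g * N\<^sub>A (e k))"
        by (meson g mult_left_mono norm_mult_le_spectral_norm order_trans spectral_norm_nonneg)
    qed (use \<eta> in auto)
    finally have dx: "norm (x (Suc k) - x k) \<le> \<dots>" .
    have diff: "N\<^sub>B (gradf (Suc k) - gradf k) \<le> l * (\<beta> * norm (x (Suc k) - x k))"
      using l[of "gradf (Suc k) - gradf k"] grad_lipschitz[of "x (Suc k)" "x k"] consts_pos
      unfolding gradf_def by (meson less_imp_le mult_left_mono order_trans)
    \<comment> \<open>\<open>B\<close> acts after the gradient correction, so the contraction also
      hits the gradient difference; hence the factor \<open>\<sigma>\<^sub>B\<close> in
      \<open>a\<^sub>6\<close> to \<open>a\<^sub>9\<close>.\<close>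
    have "r (Suc k) = (B - Binf) *v (r k + (gradf (Suc k) - gradf k))"
      by (simp add: r_def y_Suc matrix_vector_mult_diff_distrib matrix_vector_right_distrib
          matrix_vector_mult_diff_rdistrib B_vec algebra_simps)
    then have "N\<^sub>B (r (Suc k)) \<le> \<sigma>\<^sub>B * N\<^sub>B (r k + (gradf (Suc k) - gradf k))"
      by (simp only: compatible_norms_contraction[OF norm_B \<sigma>\<^sub>B(3)])
    also have "\<dots> \<le> \<sigma>\<^sub>B * (N\<^sub>B (r k) + N\<^sub>B (gradf (Suc k) - gradf k))"
      using norms(2) \<sigma>\<^sub>B by (intro mult_left_mono) (auto simp: is_norm_def)
    also have "\<dots> \<le> \<sigma>\<^sub>B * (N\<^sub>B (r k) + l * (\<beta> * (?sD * (g * N\<^sub>A (e k))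
        + \<eta> * (?sB * \<beta> * (g * N\<^sub>A (e k) + norm (d k)) + h * N\<^sub>B (r k)))))"
      using \<sigma>\<^sub>B consts_pos \<alpha>\<beta>
      by (intro mult_left_mono add_left_mono order_trans[OF diff] dx) auto
    finally show ?thesis
      by (simp add: a\<^sub>6_def a\<^sub>7_def a\<^sub>8_def a\<^sub>9_def algebra_simps power2_eq_square)
  qed

  \<comment> \<open>The recursions in matrix form\<close>
  have J: "J \<in> carrier_mat 3 3"
    by (intro carrier_matI) (simp_all add: J_def mat_of_rows_list_def)
  have t: "t k \<in> carrier_vec 3" for k
    by (intro carrier_vecI) (simp add: t_def)
  have t_nth: "vec_index (t k) 0 = N\<^sub>A (e k)" "vec_index (t k) 1 = norm (d k)"
    "vec_index (t k) 2 = N\<^sub>B (r k)" for k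
    unfolding t_def e_def d_def r_def vec_of_list_index by simp_all
  have J_nth:
    "J $$ (0, 0) = \<sigma>\<^sub>A + a\<^sub>1 * \<eta>" "J $$ (0, 1) = a\<^sub>2 * \<eta>" "J $$ (0, 2) = a\<^sub>3 * \<eta>"
    "J $$ (1, 0) = a\<^sub>4 * \<eta>" "J $$ (1, 1) = lam" "J $$ (1, 2) = a\<^sub>5 * \<eta>"
    "J $$ (2, 0) = a\<^sub>6 + a\<^sub>7 * \<eta>" "J $$ (2, 1) = a\<^sub>8 * \<eta>" "J $$ (2, 2) = \<sigma>\<^sub>B + a\<^sub>9 * \<eta>"
    by (simp_all add: J_def mat_of_rows_list_def)
  have all_less_3: "(\<forall>i<3. P i) \<longleftrightarrow> P 0 \<and> P 1 \<and> P 2" for P :: "nat \<Rightarrow> bool"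
    by (auto simp: less_Suc_eq numeral_3_eq_3 numeral_2_eq_2)
  have sum_less_3: "(\<Sum>j<3. p j) = p 0 + p 1 + p 2" for p :: "nat \<Rightarrow> real"
    by (simp add: numeral_3_eq_3 numeral_2_eq_2)
  have step: "t (Suc k) \<le> J *\<^sub>v t k" if "0 < \<eta>" "0 < \<theta>" for k
  proof -
    have "\<forall>i<3. vec_index (t (Suc k)) i \<le> (\<Sum>j<3. J $$ (i, j) * vec_index (t k) j)"
      unfolding all_less_3 sum_less_3 t_nth J_nth using row1 row2 row3 that by simp
    then show ?thesis
      using J t mult_mat_vec_nth[OF J t] by (simp add: less_eq_vec_def carrier_vecD)
  qed

  \<comment> \<open>Spectral radius below 1 and geometric convergence\<close>
  have conv: "spectral_radius (map_mat complex_of_real J) < 1 \<and>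
       (\<lambda>k. norm (x k - kron_vec 1 xstar)) \<longlonglongrightarrow> 0 \<and>
       (\<lambda>k. norm (x k - kron_vec 1 xstar))
         \<in> O(\<lambda>k. spectral_radius (map_mat complex_of_real J) ^ k)"
    if \<epsilon>: "0 < \<epsilon>\<^sub>1" "0 < \<epsilon>\<^sub>2" "0 < \<epsilon>\<^sub>3"
      and \<epsilon>\<^sub>1: "\<epsilon>\<^sub>1 < (1 - \<sigma>\<^sub>B) * \<epsilon>\<^sub>3 / a\<^sub>6"
      and \<epsilon>\<^sub>2: "\<epsilon>\<^sub>2 > (a\<^sub>4 * \<epsilon>\<^sub>1 + a\<^sub>5 * \<epsilon>\<^sub>3) / (\<alpha> * n * \<theta>)"
      and \<eta>: "0 < \<eta>"
      and \<eta>1: "\<eta> < \<epsilon>\<^sub>1 * (1 - \<sigma>\<^sub>A) / (a\<^sub>1 * \<epsilon>\<^sub>1 + a\<^sub>2 * \<epsilon>\<^sub>2 + a\<^sub>3 * \<epsilon>\<^sub>3)"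
      and \<eta>3: "\<eta> < ((1 - \<sigma>\<^sub>B) * \<epsilon>\<^sub>3 - \<epsilon>\<^sub>1 * a\<^sub>6) / (a\<^sub>7 * \<epsilon>\<^sub>1 + a\<^sub>8 * \<epsilon>\<^sub>2 + a\<^sub>9 * \<epsilon>\<^sub>3)"
      and \<eta>2: "\<eta> < 1 / (n * \<beta> * \<theta>)"
    for \<epsilon>\<^sub>1 \<epsilon>\<^sub>2 \<epsilon>\<^sub>3
  proof -
    let ?\<rho> = "spectral_radius (map_mat complex_of_real J)"
    have \<theta>: "0 < \<theta>" using \<theta>_pos \<eta> \<eta>2 by fastforce
    \<comment> \<open>Rows of \<open>Ainf\<close> belonging to two different agents agree, while
      those of the identity do not; this is where a second agent enters.\<close>
    obtain i j :: 'n where ij: "i \<noteq> j"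
      using n_ge_2 by (metis card_2_iff' ex_card obtain_subset_with_card_n subset_UNIV)
    have "Ainf $ (i, undefined) $ (i, undefined) = \<pi>\<^sub>r $ i"
      "Ainf $ (j, undefined) $ (i, undefined) = \<pi>\<^sub>r $ i"
      by (simp_all add: Ainf_def kron_def outer_prod_def Finite_Cartesian_Product.mat_def)
    moreover have "I\<^sub>n\<^sub>p $ (i, undefined) $ (i, undefined) = 1"
      "I\<^sub>n\<^sub>p $ (j, undefined) $ (i, undefined) = 0"
      using ij by (simp_all add: I_def Finite_Cartesian_Product.mat_def)
    ultimately have "I\<^sub>n\<^sub>p \<noteq> Ainf" by force
    then have sI: "0 < ?sI" by (intro spectral_norm_pos) simp
    have "Ainf *v kron_vec 1 1 = kron_vec 1 1"
      using \<pi>\<^sub>r(2) by (simp add: Ainf_vec block_kron_vec inner_vec_def flip: scaleR_sum_left)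
    moreover have "kron_vec 1 1 \<noteq> (0 :: real^('n \<times> 'p))"
      by (simp add: kron_vec_def Finite_Cartesian_Product.vec_eq_iff)
    ultimately have "Ainf \<noteq> 0" by auto
    then have sA: "0 < ?sA" by (rule spectral_norm_pos)
    obtain i where "\<pi>\<^sub>c $ i \<noteq> 0"
      using \<pi>\<^sub>c(2) by (force simp: inner_vec_def)
    then have "Binf $ (i, undefined) $ (i, undefined) \<noteq> 0"
      by (simp add: Binf_def kron_def outer_prod_def Finite_Cartesian_Product.mat_def)
    then have "Binf \<noteq> 0" by auto
    then have sB: "0 < ?sB" by (rule spectral_norm_pos)
    \<comment> \<open>If \<open>a\<^sub>6\<close> were 0, the bound on
      \<open>\<epsilon>\<^sub>1\<close> would be a division by zero, thus 0, contradicting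
      \<open>0 < \<epsilon>\<^sub>1\<close>.\<close>
    have "a\<^sub>6 \<noteq> 0" using \<epsilon>\<^sub>1 \<epsilon>(1) by auto
    moreover have "0 \<le> a\<^sub>6"
      unfolding a\<^sub>6_def using consts_pos \<sigma>\<^sub>B \<alpha>\<beta>
      by (intro mult_nonneg_nonneg spectral_norm_nonneg) auto
    ultimately have a6: "0 < a\<^sub>6" by simp
    have a_pos: "0 < a\<^sub>1" "0 < a\<^sub>2" "0 < a\<^sub>3" "0 < a\<^sub>4" "0 < a\<^sub>5" "0 < a\<^sub>7" "0 < a\<^sub>8" "0 < a\<^sub>9"
      using consts_pos \<sigma>\<^sub>B \<alpha>\<beta> sI sA sB \<theta> n_pos
      by (simp_all add: a\<^sub>1_def a\<^sub>2_def a\<^sub>3_def a\<^sub>4_def a\<^sub>5_def a\<^sub>7_def a\<^sub>8_def a\<^sub>9_def)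
    \<comment> \<open>Both terms inside the maximum are then positive, and \<alpha> \<le> \<beta>
      makes the first the larger. This gives \<open>lam\<close> in closed form and makes the middle
      entry of \<open>J\<close> positive.\<close>
    have "\<beta> * n * \<eta> * \<theta> < 1"
      using \<eta>2 n_pos \<alpha>\<beta> \<theta> by (simp add: pos_less_divide_eq mult_ac)
    moreover have "\<alpha> * n * \<eta> * \<theta> \<le> \<beta> * n * \<eta> * \<theta>"
      using \<alpha>_le_\<beta> n_pos \<eta> \<theta> by (intro mult_right_mono) auto
    ultimately have lam: "lam = 1 - \<alpha> * n * \<eta> * \<theta>" "0 < lam"
      unfolding lam_def by auto
    have "\<forall>i<3. \<forall>j<3. 0 < J $$ (i, j)"
      unfolding all_less_3 J_nth using a_pos a6 lam \<eta> \<sigma>\<^sub>A \<sigma>\<^sub>B by (simp add: add_pos_pos)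
    then have J_pos: "0 < J $$ (i, j)" if "i < 3" "j < 3" for i j
      using that by blast

    define \<epsilon> where "\<epsilon> = (!) [\<epsilon>\<^sub>1, \<epsilon>\<^sub>2, \<epsilon>\<^sub>3]"
    have \<epsilon>_nth: "\<epsilon> 0 = \<epsilon>\<^sub>1" "\<epsilon> 1 = \<epsilon>\<^sub>2" "\<epsilon> 2 = \<epsilon>\<^sub>3" by (simp_all add: \<epsilon>_def)
    \<comment> \<open>Clearing denominators gives the three rows of
      \<open>J \<epsilon> < \<epsilon>\<close>: the first and third from bounds on \<eta>, the
      second from the bound on \<open>\<epsilon>\<^sub>2\<close>.\<close>
    have 1: "\<eta> * (a\<^sub>1 * \<epsilon>\<^sub>1 + a\<^sub>2 * \<epsilon>\<^sub>2 + a\<^sub>3 * \<epsilon>\<^sub>3) < \<epsilon>\<^sub>1 * (1 - \<sigma>\<^sub>A)"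
      using \<eta>1 a_pos \<epsilon> by (simp add: pos_less_divide_eq add_pos_pos)
    have 2: "\<eta> * (a\<^sub>4 * \<epsilon>\<^sub>1 + a\<^sub>5 * \<epsilon>\<^sub>3) < \<eta> * (\<epsilon>\<^sub>2 * (\<alpha> * n * \<theta>))"
      using \<epsilon>\<^sub>2 \<eta> \<alpha>\<beta> n_pos \<theta> by (simp add: pos_divide_less_eq)
    have 3: "\<eta> * (a\<^sub>7 * \<epsilon>\<^sub>1 + a\<^sub>8 * \<epsilon>\<^sub>2 + a\<^sub>9 * \<epsilon>\<^sub>3) < (1 - \<sigma>\<^sub>B) * \<epsilon>\<^sub>3 - \<epsilon>\<^sub>1 * a\<^sub>6"
      using \<eta>3 a_pos \<epsilon> by (simp add: pos_less_divide_eq add_pos_pos)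
    have "\<forall>i<3. 0 < \<epsilon> i" "\<forall>i<3. (\<Sum>j<3. J $$ (i, j) * \<epsilon> j) < \<epsilon> i"
      unfolding all_less_3 sum_less_3 J_nth \<epsilon>_nth lam(1)
      using \<epsilon> 1 2 3 by (simp_all add: algebra_simps)
    then have \<rho>: "?\<rho> < 1"
      using J_pos by (intro spectral_radius_less_1_if_subinvariant[OF J, of \<epsilon>]) (auto intro: less_imp_le)
    have \<rho>0: "0 \<le> ?\<rho>"
      using J spectral_radius_eigenvector[of "map_mat complex_of_real J" 3]
      by (metis map_carrier_mat norm_ge_zero zero_less_numeral)

    \<comment> \<open>The growth lemma takes its dimension from a type; the numeral type
      \<open>3\<close> serves here.\<close>
    have card_3: "CARD(3) = 3" by simp
    obtain C where C: "vec_index (t k) i \<le> C * ?\<rho> ^ k" if "i < 3" for k i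
      using positive_recursion_growth[where 'n = 3 and J = J and t = t, unfolded card_3, OF J J_pos t step[OF \<eta> \<theta>]]
      by blast
    have bound: "norm (x k - kron_vec 1 xstar) \<le> (g * C + C) * ?\<rho> ^ k" for k
    proof -
      have "N\<^sub>A (e k) \<le> C * ?\<rho> ^ k" "norm (d k) \<le> C * ?\<rho> ^ k"
        using C[of 0 k, unfolded t_nth] C[of 1 k, unfolded t_nth] by simp_all
      then have "g * N\<^sub>A (e k) + norm (d k) \<le> g * (C * ?\<rho> ^ k) + C * ?\<rho> ^ k"
        using consts_pos by (intro add_mono mult_left_mono) auto
      with norm_x[of k] show ?thesis by (simp add: algebra_simps)
    qed
    have "(\<lambda>k. (g * C + C) * ?\<rho> ^ k) \<longlonglongrightarrow> 0"
      using \<rho> \<rho>0 by (intro tendsto_mult_right_zero LIMSEQ_power_zero) simp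
    then have "(\<lambda>k. norm (x k - kron_vec 1 xstar)) \<longlonglongrightarrow> 0"
      by (rule Lim_null_comparison[rotated]) (simp add: bound)
    moreover have "(\<lambda>k. norm (x k - kron_vec 1 xstar)) \<in> O(\<lambda>k. ?\<rho> ^ k)"
      using bound \<rho>0 by (intro bigoI[of _ "g * C + C"]) simp
    ultimately show ?thesis using \<rho> by blast
  qed

  show ?thesis
    using step conv \<theta>_pos[of 2] by auto
qed

end
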